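(* Consider a standard gambling game $(X,Y,\Gamma,\Lambda,u)$ and let $v\in\mathcal C(X\times Y)$ be excessive and depressive. Then: (i) if $\Gamma$ is strongly acyclic and $v$ satisfies (E1), then $v$ satisfies (MZ1); (ii) if $\Lambda$ is strongly acyclic and $v$ satisfies (E2), then $v$ satisfies (MZ2). Consequently, if the gambling game is strongly acyclic (both $\Gamma$ and $\Lambda$ are strongly acyclic), then for such $v$ the three characterizations [(MZ1) and (MZ2)], [(P1) and (P2)], [(E1) and (E2)] are equivalent.
   Context: For a compact metric space $S$: $\Delta(S)$ is the set of Borel probabilities on $S$ (weak-* topology, metrized by the Kantorovich–Rubinstein distance $d_{KR}(p,p')=\sup\{|\int f\,dp-\int f\,dp'| : f \text{ 1-Lipschitz on } S\}$), $\mathcal B(S)$ the bounded measurable real functions, $\mathcal C(S)$ the continuous real functions, $\delta_s$ the Dirac mass at $s$ (identified with $s$). For $\varphi\in\mathcal B(S)$, $\tilde\varphi(p)=\int\varphi\,dp$. For $v\in\mathcal B(X\times Y)$, $\tilde v(p,q)=\int\int v(x,y)\,dp(x)\,dq(y)$, $\tilde v(p,y)=\tilde v(p,\delta_y)$, $\tilde v(x,q)=\tilde v(\delta_x,q)$; likewise $\tilde u$. A standard gambling game consists of nonempty compact metric spaces $X,Y$, a continuous payoff $u:X\times Y\to\mathbb R$, and multifunctions $\Gamma:X\rightrightarrows\Delta(X)$, $\Lambda:Y\rightrightarrows\Delta(Y)$ with nonempty convex compact values which are leavable ($\delta_x\in\Gamma(x)$, $\delta_y\in\Lambda(y)$ for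 all $x,y$) and non expansive (for all $x,x'\in X$ and $p\in\Gamma(x)$ there is $p'\in\Gamma(x')$ with $d_{KR}(p,p')\le d(x,x')$; similarly for $\Lambda$). $v\in\mathcal B(X\times Y)$ is excessive (with respect to $X$) if $v(x,y)=\max_{p\in\Gamma(x)}\tilde v(p,y)$ for all $(x,y)$, and depressive (with respect to $Y$) if $v(x,y)=\min_{q\in\Lambda(y)}\tilde v(x,q)$ for all $(x,y)$. For $g\in\mathcal B(X\times Y)$, $Exc_\Gamma(g)$ is the smallest excessive function that is $\ge g$, and $Dep_\Lambda(g)$ is the largest depressive function that is $\le g$. $\tilde\Gamma:\Delta(X)\rightrightarrows\Delta(X)$ is the multifunction whose graph is the closed convex hull of $\{(\delta_x,p):x\in X,\,p\in\Gamma(x)\}$ in $\Delta(X)\times\Delta(X)$; $\tilde\Gamma^0(p)=\{p\}$, $\tilde\Gamma^{n+1}=\tilde\Gamma^n\circ\tilde\Gamma$; $\Gamma^\infty(x)$ is the closure of $\bigcup_{n\ge0}\tilde\Gamma^n(\delta_x)$. $\Lambda^\infty(y)$ is defined similarly. $\Gamma$ is strongly acyclic if there is a lower semicontinuous $\varphi\in\mathcal B(X)$ with $\operatorname{Argmax}_{p\in\Gamma^\infty(x)}\tilde\varphi(p)=\{\delta_x\}$ for all $x\in X$; $\Lambda$ is strongly acyclic if there is an upper semicontinuous $\psi\in\mathcal B(Y)$ with $\operatorname{Argmin}_{q\in\Lambda^\infty(y)}\tilde\psi(q)=\{\delta_y\}$ for all $y\in Y$. Properties of $v$: (MZ1) $v=Exc_\Gamma(\min(u,v))$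 on $X\times Y$. (MZ2) $v=Dep_\Lambda(\max(u,v))$ on $X\times Y$. (P1) for all $(x,y)$ there is $p\in\Gamma^\infty(x)$ with $v(x,y)=\tilde v(p,y)\le\tilde u(p,y)$. (P2) for all $(x,y)$ there is $q\in\Lambda^\infty(y)$ with $v(x,y)=\tilde v(x,q)\ge\tilde u(x,q)$. (E1) for all $(x,y)$, if $\operatorname{Argmax}_{p\in\Gamma^\infty(x)}\tilde v(p,y)=\{\delta_x\}$ then $v(x,y)\le u(x,y)$. (E2) for all $(x,y)$, if $\operatorname{Argmin}_{q\in\Lambda^\infty(y)}\tilde v(x,q)=\{\delta_y\}$ then $v(x,y)\ge u(x,y)$. *)

theory Defs
  imports "HOL-Probability.Probability"
begin

text \<open>
  A compact metric space is modelled by a type of class \<^class>\<open>metric_space\<close> whose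
  universe is compact (types are nonempty); the two spaces are two independent type variables.
\<close>

abbreviation Delta :: "'a::topological_space measure set" where
  "Delta \<equiv> space (prob_algebra borel)"

abbreviation dirac :: "'a::topological_space \<Rightarrow> 'a measure" where
  "dirac x \<equiv> return borel x"

definition bounded_borel :: "('a::topological_space \<Rightarrow> real) \<Rightarrow> bool" where
  "bounded_borel f \<longleftrightarrow> f \<in> borel_measurable borel \<and> bounded (range f)"

text \<open>The coarsest topology making \<open>p \<mapsto> \<integral>f dp\<close> continuous for every continuous \<open>f\<close>.\<close>

definition weak_star :: "'a::topological_space measure topology" where
  "weak_star = topology_generated_by
     {{p \<in> Delta. (\<integral>x. f x \<partial>p) \<in> U} | f U. continuous_on UNIV f \<and> open (U :: real set)}"

lemma topspace_weak_star: "topspace weak_star = (Delta :: 'a::topological_space measure set)"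
proof -
  have "(Delta :: 'a measure set) \<in>
      {{p \<in> Delta. (\<integral>x. f x \<partial>p) \<in> U} | f U. continuous_on UNIV f \<and> open (U :: real set)}"
    by (rule CollectI, rule exI[of _ "\<lambda>_. 0"], rule exI[of _ UNIV]) auto
  then show ?thesis
    unfolding weak_star_def topology_generated_by_topspace by blast
qed

text \<open>On a compact space the set of reals below is bounded, so that \<open>SUP\<close> is a genuine supremum.\<close>

definition d_KR :: "'a::metric_space measure \<Rightarrow> 'a measure \<Rightarrow> real" where
  "d_KR p p' = (SUP f \<in> {f :: 'a \<Rightarrow> real. 1-lipschitz_on UNIV f}. \<bar>(\<integral>x. f x \<partial>p) - (\<integral>x. f x \<partial>p')\<bar>)"

definition mix :: "real \<Rightarrow> 'a::topological_space measure \<Rightarrow> 'a measure \<Rightarrow> 'a measure" where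
  "mix t p q = measure_of UNIV (sets borel)
     (\<lambda>A. ennreal (1 - t) * emeasure p A + ennreal t * emeasure q A)"

lemma emeasure_mix:
  assumes "p \<in> Delta" "q \<in> Delta" "A \<in> sets borel"
  shows "emeasure (mix t p q) A = ennreal (1 - t) * emeasure p A + ennreal t * emeasure q A"
  unfolding mix_def
proof (rule emeasure_measure_of_sigma)
  have s: "sets p = sets borel" "sets q = sets borel"
    using assms by (auto simp: space_prob_algebra)
  show "sigma_algebra UNIV (sets (borel :: 'a measure))"
    using sets.sigma_algebra_axioms[of "borel :: 'a measure"] by simp
  show "positive (sets borel) (\<lambda>A. ennreal (1 - t) * emeasure p A + ennreal t * emeasure q A)"
    by (simp add: positive_def)
  show "countably_additive (sets borel)
      (\<lambda>A. ennreal (1 - t) * emeasure p A + ennreal t * emeasure q A)"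
    unfolding countably_additive_def
    by (auto simp: suminf_add[symmetric] suminf_emeasure s)
qed (use assms in auto)

definition convex_probs :: "'a::topological_space measure set \<Rightarrow> bool" where
  "convex_probs C \<longleftrightarrow> (\<forall>p\<in>C. \<forall>q\<in>C. \<forall>t\<in>{0..1}. mix t p q \<in> C)"

definition convex_prob_pairs :: "('a::topological_space measure \<times> 'a measure) set \<Rightarrow> bool" where
  "convex_prob_pairs C \<longleftrightarrow>
     (\<forall>(p, p')\<in>C. \<forall>(q, q')\<in>C. \<forall>t\<in>{0..1}. (mix t p q, mix t p' q') \<in> C)"

definition closed_convex_hull_pairs ::
    "('a::topological_space measure \<times> 'a measure) set \<Rightarrow> ('a measure \<times> 'a measure) set" where
  "closed_convex_hull_pairs G =
     \<Inter>{C. closedin (prod_topology weak_star weak_star) C \<and> convex_prob_pairs C \<and> G \<subseteq> C}"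

definition non_expansive :: "('a::metric_space \<Rightarrow> 'a measure set) \<Rightarrow> bool" where
  "non_expansive \<Gamma> \<longleftrightarrow> (\<forall>x x'. \<forall>p\<in>\<Gamma> x. \<exists>p'\<in>\<Gamma> x'. d_KR p p' \<le> dist x x')"

definition leavable :: "('a::topological_space \<Rightarrow> 'a measure set) \<Rightarrow> bool" where
  "leavable \<Gamma> \<longleftrightarrow> (\<forall>x. dirac x \<in> \<Gamma> x)"

definition standard_gambling_house :: "('a::metric_space \<Rightarrow> 'a measure set) \<Rightarrow> bool" where
  "standard_gambling_house \<Gamma> \<longleftrightarrow>
     compact (UNIV :: 'a set) \<and>
     (\<forall>x. \<Gamma> x \<noteq> {} \<and> \<Gamma> x \<subseteq> Delta \<and> convex_probs (\<Gamma> x) \<and> compactin weak_star (\<Gamma> x)) \<and>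
     leavable \<Gamma> \<and> non_expansive \<Gamma>"

definition standard_gambling_game ::
    "('a::metric_space \<Rightarrow> 'a measure set) \<Rightarrow> ('b::metric_space \<Rightarrow> 'b measure set) \<Rightarrow>
     ('a \<times> 'b \<Rightarrow> real) \<Rightarrow> bool" where
  "standard_gambling_game \<Gamma> \<Lambda> u \<longleftrightarrow>
     standard_gambling_house \<Gamma> \<and> standard_gambling_house \<Lambda> \<and> continuous_on UNIV u"

definition Gamma_tilde :: "('a::topological_space \<Rightarrow> 'a measure set) \<Rightarrow> 'a measure \<Rightarrow> 'a measure set" where
  "Gamma_tilde \<Gamma> p = {p'. (p, p') \<in> closed_convex_hull_pairs {(dirac x, r) | x r. r \<in> \<Gamma> x}}"

fun Gamma_tilde_pow ::
    "nat \<Rightarrow> ('a::topological_space \<Rightarrow> 'a measure set) \<Rightarrow> 'a measure \<Rightarrow> 'a measure set" where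
  "Gamma_tilde_pow 0 \<Gamma> p = {p}"
| "Gamma_tilde_pow (Suc n) \<Gamma> p = (\<Union>p'\<in>Gamma_tilde \<Gamma> p. Gamma_tilde_pow n \<Gamma> p')"

definition Gamma_inf :: "('a::topological_space \<Rightarrow> 'a measure set) \<Rightarrow> 'a \<Rightarrow> 'a measure set" where
  "Gamma_inf \<Gamma> x = weak_star closure_of (\<Union>n. Gamma_tilde_pow n \<Gamma> (dirac x))"

definition Argmax_on :: "'c set \<Rightarrow> ('c \<Rightarrow> real) \<Rightarrow> 'c set" where
  "Argmax_on S f = {p \<in> S. \<forall>p'\<in>S. f p' \<le> f p}"

definition Argmin_on :: "'c set \<Rightarrow> ('c \<Rightarrow> real) \<Rightarrow> 'c set" where
  "Argmin_on S f = {p \<in> S. \<forall>p'\<in>S. f p \<le> f p'}"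

definition lower_semicontinuous :: "('a::topological_space \<Rightarrow> real) \<Rightarrow> bool" where
  "lower_semicontinuous f \<longleftrightarrow> (\<forall>a. open {x. a < f x})"

definition upper_semicontinuous :: "('a::topological_space \<Rightarrow> real) \<Rightarrow> bool" where
  "upper_semicontinuous f \<longleftrightarrow> (\<forall>a. open {x. f x < a})"

definition strongly_acyclic_max :: "('a::topological_space \<Rightarrow> 'a measure set) \<Rightarrow> bool" where
  "strongly_acyclic_max \<Gamma> \<longleftrightarrow>
     (\<exists>\<phi>. bounded_borel \<phi> \<and> lower_semicontinuous \<phi> \<and>
       (\<forall>x. Argmax_on (Gamma_inf \<Gamma> x) (\<lambda>p. \<integral>z. \<phi> z \<partial>p) = {dirac x}))"

definition strongly_acyclic_min :: "('b::topological_space \<Rightarrow> 'b measure set) \<Rightarrow> bool" where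
  "strongly_acyclic_min \<Lambda> \<longleftrightarrow>
     (\<exists>\<psi>. bounded_borel \<psi> \<and> upper_semicontinuous \<psi> \<and>
       (\<forall>y. Argmin_on (Gamma_inf \<Lambda> y) (\<lambda>q. \<integral>z. \<psi> z \<partial>q) = {dirac y}))"

definition bilin :: "('a \<times> 'b \<Rightarrow> real) \<Rightarrow> 'a measure \<Rightarrow> 'b measure \<Rightarrow> real" where
  "bilin v p q = (\<integral>y. (\<integral>x. v (x, y) \<partial>p) \<partial>q)"

definition is_max_of :: "real \<Rightarrow> real set \<Rightarrow> bool" where
  "is_max_of m S \<longleftrightarrow> m \<in> S \<and> (\<forall>s\<in>S. s \<le> m)"

definition is_min_of :: "real \<Rightarrow> real set \<Rightarrow> bool" where
  "is_min_of m S \<longleftrightarrow> m \<in> S \<and> (\<forall>s\<in>S. m \<le> s)"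

definition excessive ::
    "('a::topological_space \<Rightarrow> 'a measure set) \<Rightarrow> ('a \<times> 'b::topological_space \<Rightarrow> real) \<Rightarrow> bool" where
  "excessive \<Gamma> v \<longleftrightarrow> bounded_borel v \<and>
     (\<forall>x y. is_max_of (v (x, y)) ((\<lambda>p. bilin v p (dirac y)) ` \<Gamma> x))"

definition depressive ::
    "('b::topological_space \<Rightarrow> 'b measure set) \<Rightarrow> ('a::topological_space \<times> 'b \<Rightarrow> real) \<Rightarrow> bool" where
  "depressive \<Lambda> v \<longleftrightarrow> bounded_borel v \<and>
     (\<forall>x y. is_min_of (v (x, y)) ((\<lambda>q. bilin v (dirac x) q) ` \<Lambda> y))"

text \<open>\<open>is_Exc \<Gamma> g w\<close> reads \<open>w = Exc\<^sub>\<Gamma>(g)\<close>: since the smallest excessive majorant need not exist for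
  every \<open>g\<close>, it is a relation rather than a total function. The order is the pointwise one.\<close>

definition is_Exc ::
    "('a::topological_space \<Rightarrow> 'a measure set) \<Rightarrow> ('a \<times> 'b::topological_space \<Rightarrow> real) \<Rightarrow>
     ('a \<times> 'b \<Rightarrow> real) \<Rightarrow> bool" where
  "is_Exc \<Gamma> g w \<longleftrightarrow> excessive \<Gamma> w \<and> g \<le> w \<and> (\<forall>w'. excessive \<Gamma> w' \<and> g \<le> w' \<longrightarrow> w \<le> w')"

definition is_Dep ::
    "('b::topological_space \<Rightarrow> 'b measure set) \<Rightarrow> ('a::topological_space \<times> 'b \<Rightarrow> real) \<Rightarrow>
     ('a \<times> 'b \<Rightarrow> real) \<Rightarrow> bool" where
  "is_Dep \<Lambda> g w \<longleftrightarrow> depressive \<Lambda> w \<and> w \<le> g \<and> (\<forall>w'. depressive \<Lambda> w' \<and> w' \<le> g \<longrightarrow> w' \<le> w)"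

definition MZ1 ::
    "('a::topological_space \<Rightarrow> 'a measure set) \<Rightarrow> ('a \<times> 'b::topological_space \<Rightarrow> real) \<Rightarrow>
     ('a \<times> 'b \<Rightarrow> real) \<Rightarrow> bool" where
  "MZ1 \<Gamma> u v \<longleftrightarrow> is_Exc \<Gamma> (\<lambda>z. min (u z) (v z)) v"

definition MZ2 ::
    "('b::topological_space \<Rightarrow> 'b measure set) \<Rightarrow> ('a::topological_space \<times> 'b \<Rightarrow> real) \<Rightarrow>
     ('a \<times> 'b \<Rightarrow> real) \<Rightarrow> bool" where
  "MZ2 \<Lambda> u v \<longleftrightarrow> is_Dep \<Lambda> (\<lambda>z. max (u z) (v z)) v"

definition P1 ::
    "('a::topological_space \<Rightarrow> 'a measure set) \<Rightarrow> ('a \<times> 'b::topological_space \<Rightarrow> real) \<Rightarrow>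
     ('a \<times> 'b \<Rightarrow> real) \<Rightarrow> bool" where
  "P1 \<Gamma> u v \<longleftrightarrow> (\<forall>x y. \<exists>p\<in>Gamma_inf \<Gamma> x.
     v (x, y) = bilin v p (dirac y) \<and> bilin v p (dirac y) \<le> bilin u p (dirac y))"

definition P2 ::
    "('b::topological_space \<Rightarrow> 'b measure set) \<Rightarrow> ('a::topological_space \<times> 'b \<Rightarrow> real) \<Rightarrow>
     ('a \<times> 'b \<Rightarrow> real) \<Rightarrow> bool" where
  "P2 \<Lambda> u v \<longleftrightarrow> (\<forall>x y. \<exists>q\<in>Gamma_inf \<Lambda> y.
     v (x, y) = bilin v (dirac x) q \<and> bilin v (dirac x) q \<ge> bilin u (dirac x) q)"

definition E1 ::
    "('a::topological_space \<Rightarrow> 'a measure set) \<Rightarrow> ('a \<times> 'b::topological_space \<Rightarrow> real) \<Rightarrow>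
     ('a \<times> 'b \<Rightarrow> real) \<Rightarrow> bool" where
  "E1 \<Gamma> u v \<longleftrightarrow> (\<forall>x y.
     Argmax_on (Gamma_inf \<Gamma> x) (\<lambda>p. bilin v p (dirac y)) = {dirac x} \<longrightarrow> v (x, y) \<le> u (x, y))"

definition E2 ::
    "('b::topological_space \<Rightarrow> 'b measure set) \<Rightarrow> ('a::topological_space \<times> 'b \<Rightarrow> real) \<Rightarrow>
     ('a \<times> 'b \<Rightarrow> real) \<Rightarrow> bool" where
  "E2 \<Lambda> u v \<longleftrightarrow> (\<forall>x y.
     Argmin_on (Gamma_inf \<Lambda> y) (\<lambda>q. bilin v (dirac x) q) = {dirac y} \<longrightarrow> v (x, y) \<ge> u (x, y))"

end

theory Submission
  imports Defs
begin

text \<open>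
  Everything can be done on one side. Swapping the two spaces and changing the sign of the payoff
  turns depressive into excessive functions and \<open>MZ2\<close>, \<open>P2\<close>, \<open>E2\<close> into \<open>MZ1\<close>, \<open>P1\<close>, \<open>E1\<close>
  (\<open>MZ2_iff_MZ1_exchange\<close> and its companions), so the theorem reduces to the cycle \<open>E1\<close>, \<open>MZ1\<close>, \<open>P1\<close>,
  \<open>E1\<close> of implications for \<open>\<Gamma>\<close>. Moreover \<open>y\<close> is only a parameter: a function is excessive exactly if it is
  bounded Borel and each of its sections in \<open>x\<close> is superharmonic (\<open>excessive_iff_superharmonic\<close>). A continuous
  superharmonic function does not increase in the mean along the whole long-run multifunction
  (\<open>Gamma_inf_integral_le\<close>), since the inequality defines a closed convex set.

  From \<open>E1\<close> to \<open>MZ1\<close> (\<open>superharmonic_majorant\<close>) one uses a maximum principle. If an excessive majorant \<open>w\<close>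
  of \<open>min u v\<close> fell below \<open>v\<close>, one would look at a maximiser \<open>x\<close> of \<open>v - w\<close> with \<open>\<phi> x\<close> minimal, where
  \<open>\<phi>\<close> is the acyclicity function. There \<open>v > u\<close>, so \<open>E1\<close> yields a nontrivial long-run move that keeps the
  mean of \<open>v\<close>; this move stays among the maximisers, where \<open>\<phi>\<close> is at least \<open>\<phi> x\<close>, although strong
  acyclicity says that every nontrivial move lowers \<open>\<phi>\<close>. As \<open>w\<close> is only Borel, it is first replaced by a
  Lipschitz lower envelope, which non-expansiveness keeps superharmonic (\<open>superharmonic_envelope\<close>).

  From \<open>MZ1\<close> to \<open>P1\<close> (\<open>MZ1_imp_P1\<close>) one computes an excessive majorant of a Lipschitz function by iterating
  the one-step maximum. Each iterate is realised by a probability in the corresponding iterate of the closed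
  convex hull (\<open>pow_follows_iterated_bet\<close>), and a limit of near-optimal probabilities is optimal. This rests
  on two facts about probabilities on a compact metric space: the finitely supported ones are dense
  (\<open>Delta_induct\<close>), and the space is sequentially compact (\<open>Delta_seq_compact\<close>). The latter is obtained by
  coding points as real numbers and applying Helly's selection theorem.

  From \<open>P1\<close> to \<open>E1\<close> (\<open>P1_imp_E1\<close>) one compares maximisers.
\<close>

section \<open>Probabilities and bounded Borel functions\<close>

lemma Delta_iff: "p \<in> Delta \<longleftrightarrow> prob_space p \<and> sets p = sets borel"
  by (auto simp: space_prob_algebra)

lemma Delta_D:
  assumes "p \<in> Delta"
  shows "prob_space p" "sets p = sets borel" "space p = UNIV"
  using assms sets_eq_imp_space_eq[of p borel] by (auto simp: Delta_iff)

lemma dirac_in_Delta: "dirac x \<in> Delta"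
  by (auto simp: Delta_iff intro: prob_space_return)

lemma bounded_borelD:
  assumes "bounded_borel f"
  obtains B where "\<And>x. \<bar>f x\<bar> \<le> B" "f \<in> borel_measurable borel"
proof -
  obtain B where "\<forall>x. \<bar>f x\<bar> \<le> B" "f \<in> borel_measurable borel"
    using assms unfolding bounded_borel_def bounded_iff by auto
  then show ?thesis using that by blast
qed

lemma bounded_borelI:
  assumes "f \<in> borel_measurable borel" "\<And>x. \<bar>f x\<bar> \<le> B"
  shows "bounded_borel f"
  using assms unfolding bounded_borel_def bounded_iff by auto

lemma bounded_borel_continuous:
  fixes f :: "'a::topological_space \<Rightarrow> real"
  assumes "compact (UNIV :: 'a set)" "continuous_on UNIV f"
  shows "bounded_borel f"
  unfolding bounded_borel_def
  using assms compact_continuous_image[of UNIV f] compact_imp_bounded borel_measurable_continuous_onI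
  by blast

lemma bounded_borel_minus: "bounded_borel f \<Longrightarrow> bounded_borel (\<lambda>x. - f x)"
  by (elim bounded_borelD) (rule bounded_borelI, auto)

lemma bounded_borel_diff:
  assumes "bounded_borel f" "bounded_borel g"
  shows "bounded_borel (\<lambda>x. f x - g x)"
proof -
  obtain A B where "\<And>x. \<bar>f x\<bar> \<le> A" "\<And>x. \<bar>g x\<bar> \<le> B"
    and m: "f \<in> borel_measurable borel" "g \<in> borel_measurable borel"
    using assms by (meson bounded_borelD)
  then have "\<bar>f x - g x\<bar> \<le> A + B" for x
    using abs_triangle_ineq4[of "f x" "g x"] by (meson add_mono order_trans)
  then show ?thesis
    using m by (intro bounded_borelI) auto
qed

lemma integrable_bounded_borel:
  assumes "p \<in> Delta" "bounded_borel f"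
  shows "integrable p f"
proof -
  interpret prob_space p using assms Delta_D by blast
  obtain B where "\<And>x. \<bar>f x\<bar> \<le> B" "f \<in> borel_measurable borel"
    using assms(2) by (rule bounded_borelD) blast
  then show ?thesis
    using Delta_D[OF assms(1)]
    by (intro integrable_const_bound[where B = B]) (auto cong: measurable_cong_sets)
qed

lemma integral_const_Delta: "p \<in> Delta \<Longrightarrow> (\<integral>x. c \<partial>p) = (c::real)"
  using prob_space.prob_space[of p] Delta_D[of p] by simp

lemma integral_le_const_Delta:
  assumes "p \<in> Delta" "bounded_borel f" "\<And>x. f x \<le> c"
  shows "(\<integral>x. f x \<partial>p) \<le> c"
proof -
  interpret prob_space p using assms Delta_D by blast
  show ?thesis
    using integral_mono[OF integrable_bounded_borel[OF assms(1,2)], of "\<lambda>_. c"] assms(3)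
      integral_const_Delta[OF assms(1), of c] by (simp add: prob_space)
qed

lemma integral_dirac:
  fixes f :: "_ \<Rightarrow> real"
  assumes "f \<in> borel_measurable borel"
  shows "(\<integral>x. f x \<partial>dirac a) = f a"
  using assms by (intro integral_return) auto

lemma bounded_borel_section:
  assumes "bounded_borel (v :: 'a::topological_space \<times> 'b::topological_space \<Rightarrow> real)"
  shows "bounded_borel (\<lambda>x. v (x, y))" "bounded_borel (\<lambda>y. v (x, y))"
proof -
  obtain B where B: "\<And>z. \<bar>v z\<bar> \<le> B" and m: "v \<in> borel_measurable borel"
    using assms by (rule bounded_borelD) blast
  have 1: "(\<lambda>x::'a. (x, y)) \<in> borel_measurable borel" "(\<lambda>y::'b. (x, y)) \<in> borel_measurable borel" for x y
    by (intro borel_measurable_continuous_onI continuous_intros)+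
  show "bounded_borel (\<lambda>x. v (x, y))" "bounded_borel (\<lambda>y. v (x, y))"
    using B m measurable_compose[OF 1(1) m] measurable_compose[OF 1(2) m]
    by (auto intro!: bounded_borelI)
qed

section \<open>Mixtures\<close>

lemma mix_in_Delta:
  assumes "p \<in> Delta" "q \<in> Delta" "t \<in> {0..1}"
  shows "mix t p q \<in> Delta"
proof -
  have s: "sets (mix t p q) = sets borel" "space (mix t p q) = UNIV"
    unfolding mix_def using sets.sigma_sets_eq[of borel] by (auto simp: space_measure_of_conv)
  have "emeasure (mix t p q) UNIV = 1"
    using assms prob_space.emeasure_space_1[OF Delta_D(1), of p]
      prob_space.emeasure_space_1[OF Delta_D(1), of q]
    by (simp add: emeasure_mix Delta_D(3) flip: ennreal_plus)
  then show ?thesis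
    unfolding Delta_iff using s by (auto intro: prob_spaceI)
qed

lemma nn_integral_mix:
  assumes pq: "p \<in> Delta" "q \<in> Delta" "t \<in> {0..1}" and f: "f \<in> borel_measurable borel"
  shows "(\<integral>\<^sup>+x. f x \<partial>mix t p q) =
    ennreal (1 - t) * (\<integral>\<^sup>+x. f x \<partial>p) + ennreal t * (\<integral>\<^sup>+x. f x \<partial>q)"
  using f
proof (induction rule: borel_measurable_induct)
  have [measurable_cong]: "sets p = sets borel" "sets q = sets borel" "sets (mix t p q) = sets borel"
    using Delta_D(2)[OF pq(1)] Delta_D(2)[OF pq(2)] Delta_D(2)[OF mix_in_Delta[OF pq]] by auto
  {
    case (cong f g)
    then have "f = g" by auto
    with cong show ?case by simp
  next
    case (set A)
    then show ?case using pq by (simp add: emeasure_mix)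
  next
    case (mult u c)
    then show ?case
      by (simp add: nn_integral_cmult distrib_left mult.left_commute)
  next
    case (add u v)
    then show ?case
      by (simp add: nn_integral_add distrib_left add.assoc add.left_commute)
  next
    case (seq U)
    have *: "ennreal c * (SUP i. \<integral>\<^sup>+ x. U i x \<partial>m) = (SUP i. ennreal c * \<integral>\<^sup>+ x. U i x \<partial>m)" for c m
      by (simp add: SUP_mult_left_ennreal)
    have "(\<integral>\<^sup>+ x. (SUP i. U i) x \<partial>m) = (SUP i. \<integral>\<^sup>+ x. U i x \<partial>m)" if "sets m = sets borel" for m
      unfolding SUP_apply
      using seq that by (intro nn_integral_monotone_convergence_SUP) (auto cong: measurable_cong_sets)
    moreover have "incseq (\<lambda>i. ennreal c * \<integral>\<^sup>+ x. U i x \<partial>m)" for c m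
      using seq by (auto simp: incseq_def le_fun_def intro!: mult_left_mono nn_integral_mono)
    ultimately show ?case
      using seq Delta_D(2)[OF pq(1)] Delta_D(2)[OF pq(2)] Delta_D(2)[OF mix_in_Delta[OF pq]]
      by (simp add: * ennreal_SUP_add)
  }
qed

lemma integral_mix:
  assumes pq: "p \<in> Delta" "q \<in> Delta" "t \<in> {0..1}" and f: "bounded_borel f"
  shows "(\<integral>x. f x \<partial>mix t p q) = (1 - t) * (\<integral>x. f x \<partial>p) + t * (\<integral>x. f x \<partial>q)"
proof -
  obtain B where B: "\<And>x. \<bar>f x\<bar> \<le> B" and m: "f \<in> borel_measurable borel"
    using f by (rule bounded_borelD) blast
  have pos: "0 \<le> f x + B" for x
    using B[of x] by linarith
  have fB: "bounded_borel (\<lambda>x. f x + B)"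
    using bounded_borel_diff[OF f, of "\<lambda>_. - B"] bounded_borelI[of "\<lambda>_. - B" "\<bar>B\<bar>"] by simp
  \<comment> \<open>Shifting by the bound reduces the claim to nonnegative integrands.\<close>
  have shift: "(\<integral>x. f x \<partial>r) = (\<integral>x. f x + B \<partial>r) - B" if "r \<in> Delta" for r
    using integrable_bounded_borel[OF that f] integral_const_Delta[OF that, of B]
      prob_space.finite_measure[OF Delta_D(1)[OF that]]
    by (simp add: finite_measure.integrable_const)
  have nn: "(\<integral>\<^sup>+x. ennreal (f x + B) \<partial>r) = ennreal (\<integral>x. f x + B \<partial>r)" if "r \<in> Delta" for r
    using integrable_bounded_borel[OF that fB] pos by (intro nn_integral_eq_integral) auto
  have ge0: "0 \<le> (\<integral>x. f x + B \<partial>r)" for r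
    using pos by simp
  have "ennreal (\<integral>x. f x + B \<partial>mix t p q) =
      ennreal ((1 - t) * (\<integral>x. f x + B \<partial>p) + t * (\<integral>x. f x + B \<partial>q))"
    using nn_integral_mix[OF pq, of "\<lambda>x. ennreal (f x + B)"] m pq ge0
    by (simp add: nn mix_in_Delta ennreal_mult ennreal_plus)
  then have "(\<integral>x. f x + B \<partial>mix t p q) = (1 - t) * (\<integral>x. f x + B \<partial>p) + t * (\<integral>x. f x + B \<partial>q)"
    using pq by (subst (asm) ennreal_inj) (auto simp: ge0 intro!: add_nonneg_nonneg mult_nonneg_nonneg)
  then show ?thesis
    unfolding shift[OF pq(1)] shift[OF pq(2)] shift[OF mix_in_Delta[OF pq]] by algebra
qed

section \<open>Weak-* convergence\<close>

lemma continuous_map_integral: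
  assumes "continuous_on UNIV f"
  shows "continuous_map weak_star euclideanreal (\<lambda>p. \<integral>x. f x \<partial>p)"
  unfolding continuous_map_def
proof (intro conjI allI impI)
  fix U :: "real set" assume "openin euclideanreal U"
  then show "openin weak_star {p \<in> topspace weak_star. (\<integral>x. f x \<partial>p) \<in> U}"
    unfolding topspace_weak_star using assms
    by (subst weak_star_def) (auto intro!: topology_generated_by_Basis)
qed auto

text \<open>
  Sequential weak-* convergence, phrased by test functions. Sequences suffice throughout because the
  set of probabilities on a compact metric space is sequentially compact.
\<close>

definition weak_lim :: "(nat \<Rightarrow> 'a::topological_space measure) \<Rightarrow> 'a measure \<Rightarrow> bool" where
  "weak_lim ps p \<longleftrightarrow> (\<forall>f. continuous_on UNIV f \<longrightarrow> (\<lambda>n. \<integral>x. f x \<partial>ps n) \<longlonglongrightarrow> (\<integral>x. f x \<partial>p :: real))"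

lemma limitin_weak_star:
  assumes "\<And>n. ps n \<in> Delta" "p \<in> Delta" "weak_lim ps p"
  shows "limitin weak_star ps p sequentially"
proof -
  have "\<forall>\<^sub>F n in sequentially. ps n \<in> U"
    if "generate_topology_on
      {{p \<in> Delta. (\<integral>x. f x \<partial>p) \<in> U} | f U. continuous_on UNIV f \<and> open (U :: real set)} U" "p \<in> U" for U
    using that
  proof (induction rule: generate_topology_on.induct)
    case (Int a b)
    then show ?case by (auto intro: eventually_conj)
  next
    case (UN K)
    then obtain k where "k \<in> K" "\<forall>\<^sub>F n in sequentially. ps n \<in> k" by blast
    then show ?case by (auto elim: eventually_mono)
  next
    case (Basis s)
    from Basis(1) obtain f and U :: "real set" where s: "s = {p \<in> Delta. (\<integral>x. f x \<partial>p) \<in> U}" "continuous_on UNIV f" "open U"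
      by blast
    have "(\<lambda>n. \<integral>x. f x \<partial>ps n) \<longlonglongrightarrow> (\<integral>x. f x \<partial>p)"
      using assms(3) s(2) by (simp add: weak_lim_def)
    then have "\<forall>\<^sub>F n in sequentially. (\<integral>x. f x \<partial>ps n) \<in> U"
      using s(1,3) Basis(2) by (intro topological_tendstoD) auto
    then show ?case
      using s(1) assms(1) by simp
  qed simp
  then show ?thesis
    unfolding limitin_def topspace_weak_star using assms(2)
    by (auto simp: weak_star_def dest: openin_topology_generated_by)
qed

section \<open>Fine covers of compact metric spaces\<close>

definition fine_cover :: "(nat \<Rightarrow> 'a::metric_space set) \<Rightarrow> real \<Rightarrow> nat set \<Rightarrow> bool" where
  "fine_cover U e I \<longleftrightarrow>
     finite I \<and> (\<forall>x. \<exists>k\<in>I. x \<in> U k) \<and> (\<forall>k\<in>I. \<forall>x\<in>U k. \<forall>y\<in>U k. dist x y < e)"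

lemma fine_coverD:
  assumes "fine_cover U e I"
  shows "finite I" "\<exists>k\<in>I. x \<in> U k" "\<lbrakk>k \<in> I; x \<in> U k; y \<in> U k\<rbrakk> \<Longrightarrow> dist x y < e"
  using assms by (auto simp: fine_cover_def)

text \<open>
  One countable family serves every scale: it consists of finite covers by balls of radius
  \<open>1 / (n + 1)\<close>, for all \<open>n\<close>. It replaces a countable base, and it also supplies the digits of the
  real coding below.
\<close>

lemma countable_fine_cover:
  assumes "compact (UNIV :: 'a::metric_space set)"
  obtains U :: "nat \<Rightarrow> 'a::metric_space set" where "\<And>k. open (U k)"
    "\<And>e. 0 < e \<Longrightarrow> \<exists>I. fine_cover U e I"
proof -
  have "\<exists>F. finite F \<and> (UNIV :: 'a set) = (\<Union>a\<in>F. ball a (1 / Suc n))" for n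
  proof -
    have "(UNIV :: 'a set) \<subseteq> (\<Union>a\<in>UNIV. ball a (1 / Suc n))" by auto
    from compactE_image[OF assms _ this] show ?thesis
      by (metis open_ball subset_antisym top_greatest)
  qed
  then obtain F :: "nat \<Rightarrow> 'a set" where
    F: "\<And>n. finite (F n)" "\<And>n. UNIV = (\<Union>a\<in>F n. ball a (1 / Suc n))"
    by metis
  define S where "S = (\<Union>n. (\<lambda>a. ball a (1 / Suc n)) ` F n)"
  have "F 0 \<noteq> {}"
    using F(2)[of 0] by auto
  then have S: "countable S" "S \<noteq> {}"
    unfolding S_def using F(1) by (auto intro!: countable_UN simp: countable_finite)
  have r: "range (from_nat_into S) = S"
    by (rule range_from_nat_into[OF S(2,1)])
  show ?thesis
  proof (rule that[of "from_nat_into S"])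
    show "open (from_nat_into S k)" for k
      using from_nat_into[OF S(2), of k] unfolding S_def by auto
  next
    fix e :: real assume "0 < e"
    then obtain n where n: "1 / Suc n < e / 2"
      by (meson half_gt_zero nat_approx_posE)
    have "(\<lambda>a. ball a (1 / Suc n)) ` F n \<subseteq> S"
      unfolding S_def by blast
    then have "(\<lambda>a. ball a (1 / Suc n)) ` F n \<subseteq> range (from_nat_into S)"
      unfolding r .
    then obtain I where I: "finite I" "(\<lambda>a. ball a (1 / Suc n)) ` F n = from_nat_into S ` I"
      using F(1) by (meson finite_imageI finite_subset_image)
    have "dist x y < e" if "k \<in> I" "x \<in> from_nat_into S k" "y \<in> from_nat_into S k" for k x y
    proof -
      have "from_nat_into S k \<in> (\<lambda>a. ball a (1 / Suc n)) ` F n"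
        unfolding I(2) using that(1) by (rule imageI)
      then obtain a where "from_nat_into S k = ball a (1 / Suc n)" by blast
      then have "dist a x < 1 / Suc n" "dist a y < 1 / Suc n"
        using that by auto
      then show ?thesis
        using n dist_triangle3[of x y a] by linarith
    qed
    moreover have "\<exists>k\<in>I. x \<in> from_nat_into S k" for x
    proof -
      have "x \<in> \<Union> ((\<lambda>a. ball a (1 / Suc n)) ` F n)"
        using F(2)[of n] by blast
      then show ?thesis unfolding I(2) by blast
    qed
    ultimately have "fine_cover (from_nat_into S) e I"
      unfolding fine_cover_def using I(1) by simp
    then show "\<exists>I. fine_cover (from_nat_into S) e I" ..
  qed
qed

text \<open>
  An open set of the product is the union of the countably many rectangles \<open>U i \<times> V j\<close> that it
  contains.
\<close>

lemma sets_borel_prod_compact: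
  assumes "compact (UNIV :: 'a::metric_space set)" "compact (UNIV :: 'b::metric_space set)"
  shows "sets (borel :: ('a \<times> 'b) measure) = sets (borel \<Otimes>\<^sub>M borel)"
proof
  obtain U :: "nat \<Rightarrow> 'a set" where U: "\<And>k. open (U k)" "\<And>e. 0 < e \<Longrightarrow> \<exists>I. fine_cover U e I"
    using countable_fine_cover[OF assms(1)] by metis
  obtain V :: "nat \<Rightarrow> 'b set" where V: "\<And>k. open (V k)" "\<And>e. 0 < e \<Longrightarrow> \<exists>I. fine_cover V e I"
    using countable_fine_cover[OF assms(2)] by metis
  have "W \<in> sets (borel \<Otimes>\<^sub>M borel)" if W: "open W" for W :: "('a \<times> 'b) set"
  proof -
    let ?J = "{(i, j). U i \<times> V j \<subseteq> W}"
    have "W = (\<Union>(i, j)\<in>?J. U i \<times> V j)"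
    proof
      show "W \<subseteq> (\<Union>(i, j)\<in>?J. U i \<times> V j)"
      proof
        fix z assume "z \<in> W"
        then obtain e where e: "0 < e" "ball z e \<subseteq> W"
          by (rule openE[OF W])
        obtain x y where z: "z = (x, y)" by (cases z)
        have e2: "0 < e / 2" using e(1) by simp
        obtain I J where IJ: "fine_cover U (e / 2) I" "fine_cover V (e / 2) J"
          using U(2)[OF e2] V(2)[OF e2] by blast
        obtain i where i: "i \<in> I" "x \<in> U i" using fine_coverD(2)[OF IJ(1)] by blast
        obtain j where j: "j \<in> J" "y \<in> V j" using fine_coverD(2)[OF IJ(2)] by blast
        have "(x', y') \<in> W" if "x' \<in> U i" "y' \<in> V j" for x' y'
        proof -
          have "dist x x' < e / 2" "dist y y' < e / 2"
            using fine_coverD(3)[OF IJ(1) i that(1)] fine_coverD(3)[OF IJ(2) j that(2)] by auto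
          moreover have "dist (x, y) (x', y') \<le> dist x x' + dist y y'"
            unfolding dist_Pair_Pair by (rule sqrt_sum_squares_le_sum) auto
          ultimately have "dist (x, y) (x', y') < e" by linarith
          then show ?thesis using e(2) z by (auto simp: subset_iff)
        qed
        then have "U i \<times> V j \<subseteq> W" by auto
        then show "z \<in> (\<Union>(i, j)\<in>?J. U i \<times> V j)"
          using i j z by auto
      qed
    qed auto
    moreover have "(\<Union>(i, j)\<in>?J. U i \<times> V j) \<in> sets (borel \<Otimes>\<^sub>M borel)"
      using U(1) V(1) by (intro sets.countable_UN'') (auto intro!: pair_measureI)
    ultimately show ?thesis by simp
  qed
  then show "sets (borel :: ('a \<times> 'b) measure) \<subseteq> sets (borel \<Otimes>\<^sub>M borel)"
    using sets.sigma_sets_subset[of "Collect open" "(borel :: 'a measure) \<Otimes>\<^sub>M (borel :: 'b measure)"]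
    by (auto simp: space_pair_measure borel_def[where 'a = "'a \<times> 'b"])
next
  have "(fst :: 'a \<times> 'b \<Rightarrow> 'a) \<in> borel_measurable borel" "(snd :: 'a \<times> 'b \<Rightarrow> 'b) \<in> borel_measurable borel"
    by (intro borel_measurable_continuous_onI continuous_intros)+
  then have "(\<lambda>z :: 'a \<times> 'b. (fst z, snd z)) \<in> borel \<rightarrow>\<^sub>M borel \<Otimes>\<^sub>M borel"
    by (rule measurable_Pair)
  then show "sets (borel \<Otimes>\<^sub>M borel) \<subseteq> sets (borel :: ('a \<times> 'b) measure)"
    by (auto dest: measurable_sets)
qed

section \<open>Integration of one variable\<close>

lemma measurable_integral_section:
  assumes c: "compact (UNIV :: 'a::metric_space set)" "compact (UNIV :: 'b::metric_space set)"
    and p: "p \<in> Delta" and w: "bounded_borel (w :: 'a \<times> 'b \<Rightarrow> real)"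
  shows "(\<lambda>y. \<integral>x. w (x, y) \<partial>p) \<in> borel_measurable borel"
proof -
  interpret prob_space p using p Delta_D by blast
  have "w \<in> borel_measurable (borel \<Otimes>\<^sub>M borel)"
    using w sets_borel_prod_compact[OF c] unfolding bounded_borel_def
    by (auto cong: measurable_cong_sets)
  then have "(\<lambda>(y, x). w (x, y)) \<in> borel_measurable (borel \<Otimes>\<^sub>M borel)"
    by (rule measurable_pair_swap)
  then have "(\<lambda>(y, x). w (x, y)) \<in> borel_measurable (borel \<Otimes>\<^sub>M p)"
    using Delta_D(2)[OF p] by (auto cong: measurable_cong_sets sets_pair_measure_cong)
  then show ?thesis
    by (rule borel_measurable_lebesgue_integral)
qed

text \<open>
  Integration against a Dirac mass is evaluation only for a Borel integrand, which is why the partial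
  integral must be shown to be measurable first.
\<close>

lemma bilin_dirac_right:
  assumes "compact (UNIV :: 'a::metric_space set)" "compact (UNIV :: 'b::metric_space set)"
    and "p \<in> Delta" and "bounded_borel (w :: 'a \<times> 'b \<Rightarrow> real)"
  shows "bilin w p (dirac y) = (\<integral>x. w (x, y) \<partial>p)"
  unfolding bilin_def by (rule integral_dirac[OF measurable_integral_section[OF assms]])

lemma bilin_dirac_left:
  assumes "bounded_borel w"
  shows "bilin w (dirac x) q = (\<integral>y. w (x, y) \<partial>q)"
  using bounded_borel_section(1)[OF assms] unfolding bilin_def bounded_borel_def
  by (simp add: integral_dirac)

section \<open>Density of finitely supported probabilities\<close>

text \<open>
  Induction on the support: a probability \<open>p\<close> that is not concentrated at \<open>a\<close> is the mixture of
  \<open>dirac a\<close> and \<open>p\<close> conditioned on the complement of \<open>a\<close>.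
\<close>

lemma finite_support_induct:
  fixes p :: "'a::t1_space measure"
  assumes "finite F" "p \<in> Delta" "emeasure p (- F) = 0"
    and dirac: "\<And>x. dirac x \<in> S"
    and mix: "\<And>p q t. \<lbrakk>p \<in> S; q \<in> S; p \<in> Delta; q \<in> Delta; t \<in> {0..1}\<rbrakk> \<Longrightarrow> mix t p q \<in> S"
  shows "p \<in> S"
  using assms(1-3)
proof (induction F arbitrary: p rule: finite_induct)
  case empty
  then show ?case
    using prob_space.emeasure_space_1[OF Delta_D(1)[OF empty(1)]] Delta_D(3)[OF empty(1)] by simp
next
  case (insert a F)
  interpret prob_space p using insert.prems Delta_D by blast
  note s[simp] = Delta_D(2,3)[OF insert.prems(1)]
  have F: "F \<in> sets borel"
    using insert.hyps(1) by (intro borel_closed finite_imp_closed)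
  define m where "m = measure p {a}"
  have m: "0 \<le> m" "m \<le> 1" "emeasure p {a} = ennreal m"
    unfolding m_def by (auto simp: emeasure_eq_measure)
  have na: "emeasure p (- {a}) = ennreal (1 - m)"
    using prob_compl[of "{a}"] by (simp add: emeasure_eq_measure m_def Compl_eq_Diff_UNIV)
  show ?case
  proof (cases "m = 1")
    case True
    have "p = dirac a"
    proof (rule measure_eqI)
      fix A assume "A \<in> sets p"
      then have A: "A \<in> sets borel" by simp
      have "emeasure p (A - {a}) \<le> emeasure p (- {a})"
        using A by (intro emeasure_mono) auto
      then have 0: "emeasure p (A - {a}) = 0"
        using na True by simp
      have "emeasure p (A \<inter> {a}) = emeasure (dirac a) A"
        using A m True by (cases "a \<in> A") auto
      moreover have "emeasure p A = emeasure p (A \<inter> {a}) + emeasure p (A - {a})"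
        using A by (subst plus_emeasure) (auto intro!: arg_cong[where f = "emeasure p"])
      ultimately show "emeasure p A = emeasure (dirac a) A" using 0 by simp
    qed auto
    then show ?thesis using dirac by simp
  next
    case False
    then have m1: "m < 1" using m by simp
    let ?q = "uniform_measure p (- {a})"
    have q: "?q \<in> Delta"
      unfolding Delta_iff using na m1 by (auto intro!: prob_space_uniform_measure)
    have "emeasure ?q (- F) = emeasure p (- {a} \<inter> - F) / emeasure p (- {a})"
      using F by (intro emeasure_uniform_measure) auto
    also have "- {a} \<inter> - F = - insert a F" by auto
    finally have "?q \<in> S"
      using insert.IH[OF q] insert.prems(2) by simp
    then have "mix (1 - m) (dirac a) ?q \<in> S"
      using m q by (intro mix dirac dirac_in_Delta) auto
    moreover have "mix (1 - m) (dirac a) ?q = p"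
    proof (rule measure_eqI)
      have "mix (1 - m) (dirac a) ?q \<in> Delta"
        using m q by (intro mix_in_Delta dirac_in_Delta) auto
      from Delta_D(2)[OF this]
      show "sets (mix (1 - m) (dirac a) ?q) = sets p" by simp
      fix A assume "A \<in> sets (mix (1 - m) (dirac a) ?q)"
      then have A: "A \<in> sets borel"
        using \<open>sets (mix (1 - m) (dirac a) ?q) = sets p\<close> by simp
      have "emeasure (mix (1 - m) (dirac a) ?q) A =
          ennreal m * indicator A a + ennreal (1 - m) * (emeasure p (- {a} \<inter> A) / ennreal (1 - m))"
        using A q na by (simp add: emeasure_mix dirac_in_Delta)
      also have "ennreal (1 - m) * (emeasure p (- {a} \<inter> A) / ennreal (1 - m)) = emeasure p (- {a} \<inter> A)"
        using m1 by (simp add: ennreal_mult_divide_eq mult.commute[of "ennreal (1 - m)"] ennreal_times_divide)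
      also have "ennreal m * indicator A a = emeasure p (A \<inter> {a})"
        using m by (cases "a \<in> A") auto
      also have "emeasure p (A \<inter> {a}) + emeasure p (- {a} \<inter> A) = emeasure p A"
        using A by (subst plus_emeasure) (auto intro!: arg_cong[where f = "emeasure p"])
      finally show "emeasure (mix (1 - m) (dirac a) ?q) A = emeasure p A" .
    qed
    ultimately show ?thesis by simp
  qed
qed

lemma finite_valued_approximation:
  assumes "compact (UNIV :: 'a::metric_space set)" "0 < e"
  obtains r :: "'a::metric_space \<Rightarrow> 'a" where "r \<in> borel_measurable borel" "finite (range r)" "\<And>x. dist (r x) x < e"
proof -
  obtain U :: "nat \<Rightarrow> 'a set" where U: "\<And>k. open (U k)" "\<exists>I. fine_cover U e I"
    using countable_fine_cover[OF assms(1)] assms(2) by metis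
  then obtain I where "fine_cover U e I" by blast
  note I = fine_coverD[OF this]
  define k where "k = (\<lambda>x. LEAST k. k \<in> I \<and> x \<in> U k)"
  have k: "k x \<in> I" "x \<in> U (k x)" for x
    using I(2) LeastI_ex[of "\<lambda>k. k \<in> I \<and> x \<in> U k"] unfolding k_def by blast+
  define c where "c = (\<lambda>k. SOME z. z \<in> U k)"
  have c: "c (k x) \<in> U (k x)" for x
    unfolding c_def using k(2) by (rule someI)
  have [measurable]: "U k \<in> sets borel" for k
    using U(1) by simp
  have "k \<in> borel \<rightarrow>\<^sub>M count_space UNIV"
    unfolding k_def by measurable
  then have "(\<lambda>x. c (k x)) \<in> borel_measurable borel"
    by (rule measurable_compose) simp
  moreover have "finite (range (\<lambda>x. c (k x)))"
    using I(1) k(1) by (auto intro: finite_subset[of _ "c ` I"])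
  ultimately show ?thesis
    using I(3)[OF k(1) c k(2)] by (rule that)
qed

text \<open>
  Pushing \<open>p\<close> forward along a finite-valued map that moves points by less than \<open>1 / (n + 1)\<close> gives a
  finitely supported probability, and these push-forwards converge to \<open>p\<close>. Hence a property of Dirac
  masses that survives mixtures and weak-* limits holds for all probabilities.
\<close>

lemma Delta_induct:
  fixes p :: "'a::metric_space measure"
  assumes X: "compact (UNIV :: 'a set)" and p: "p \<in> Delta"
    and dirac: "\<And>x. dirac x \<in> S"
    and mix: "\<And>p q t. \<lbrakk>p \<in> S; q \<in> S; p \<in> Delta; q \<in> Delta; t \<in> {0..1}\<rbrakk> \<Longrightarrow> mix t p q \<in> S"
    and lim: "\<And>ps p. \<lbrakk>\<And>n. ps n \<in> S; \<And>n. ps n \<in> Delta; p \<in> Delta; weak_lim ps p\<rbrakk> \<Longrightarrow> p \<in> S"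
  shows "p \<in> S"
proof -
  interpret prob_space p using p Delta_D by blast
  note s[measurable_cong, simp] = Delta_D(2,3)[OF p]
  have "\<exists>r :: 'a \<Rightarrow> 'a. r \<in> borel_measurable borel \<and> finite (range r) \<and> (\<forall>x. dist (r x) x < inverse (Suc n))" for n
    using finite_valued_approximation[OF X, of "inverse (Suc n)"]
    by (metis inverse_positive_iff_positive of_nat_0_less_iff zero_less_Suc)
  then obtain r :: "nat \<Rightarrow> 'a \<Rightarrow> 'a" where
    r[measurable]: "\<And>n. r n \<in> borel_measurable borel" and fin: "\<And>n. finite (range (r n))"
    and near: "\<And>n x. dist (r n x) x < inverse (Suc n)"
    by metis
  have r': "r n \<in> p \<rightarrow>\<^sub>M borel" for n by simp
  define ps where "ps = (\<lambda>n. distr p borel (r n))"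
  have ps: "ps n \<in> Delta" for n
    unfolding Delta_iff ps_def using r' by (auto intro: prob_space_distr)
  show ?thesis
  proof (rule lim[of ps, OF _ ps p])
    fix n
    have "- range (r n) \<in> sets borel"
      using fin by (intro borel_open) (simp add: finite_imp_closed open_Compl)
    then have "emeasure (ps n) (- range (r n)) = emeasure p (r n -` (- range (r n)) \<inter> space p)"
      unfolding ps_def using r' by (intro emeasure_distr) auto
    also have "r n -` (- range (r n)) \<inter> space p = {}" by auto
    finally show "ps n \<in> S"
      using finite_support_induct[OF fin ps _ dirac mix, of n n] by simp
  next
    show "weak_lim ps p"
      unfolding weak_lim_def
    proof (intro allI impI)
      fix f :: "'a \<Rightarrow> real" assume f: "continuous_on UNIV f"
      then have fm[measurable]: "f \<in> borel_measurable borel" and fb: "bounded_borel f"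
        using bounded_borel_continuous[OF X] by (auto simp: bounded_borel_def)
      obtain B where B: "\<And>x. \<bar>f x\<bar> \<le> B" using fb by (rule bounded_borelD) blast
      have "(\<lambda>n. \<integral>x. f (r n x) \<partial>p) \<longlonglongrightarrow> (\<integral>x. f x \<partial>p)"
      proof (rule integral_dominated_convergence[where w = "\<lambda>_. B"])
        have "(\<lambda>n. r n x) \<longlonglongrightarrow> x" for x
        proof (rule metric_tendsto_imp_tendsto[of "\<lambda>n. inverse (real (Suc n))" 0])
          show "(\<lambda>n. inverse (real (Suc n))) \<longlonglongrightarrow> 0" by (rule LIMSEQ_inverse_real_of_nat)
          show "\<forall>\<^sub>F n in sequentially. dist (r n x) x \<le> dist (inverse (real (Suc n))) 0"
            using near by (auto intro!: always_eventually less_imp_le simp del: of_nat_Suc)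
        qed
        then show "AE x in p. (\<lambda>n. f (r n x)) \<longlonglongrightarrow> f x"
          using f by (auto intro!: continuous_on_tendsto_compose[OF f])
      qed (use B in auto)
      then show "(\<lambda>n. \<integral>x. f x \<partial>ps n) \<longlonglongrightarrow> (\<integral>x. f x \<partial>p)"
        unfolding ps_def using integral_distr[OF r' fm] by simp
    qed
  qed
qed

section \<open>Sequential compactness of the set of probabilities\<close>

text \<open>
  The \<open>k\<close>-th base-3 digit is the membership bit of \<open>U k\<close>. Using only the digits 0 and 1 in base 3
  makes the expansion stable: two codes that are close have a common initial segment of digits.
\<close>

definition ternary_code :: "(nat \<Rightarrow> 'a set) \<Rightarrow> 'a \<Rightarrow> real" where
  "ternary_code U x = (\<Sum>k. indicator (U k) x * (1/3) ^ k)"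

lemma summable_ternary: "summable (\<lambda>k. indicator (U k) x * (1/3 :: real) ^ k)"
  by (rule summable_comparison_test[OF _ summable_geometric[of "1/3::real"]])
     (auto simp: indicator_def)

lemma ternary_code_bounds: "0 \<le> ternary_code U x" "ternary_code U x \<le> 3/2"
proof -
  show "0 \<le> ternary_code U x"
    unfolding ternary_code_def by (rule suminf_nonneg[OF summable_ternary]) auto
  have "ternary_code U x \<le> (\<Sum>k. (1/3::real) ^ k)"
    unfolding ternary_code_def
    by (rule suminf_le[OF _ summable_ternary summable_geometric]) (auto simp: indicator_def)
  then show "ternary_code U x \<le> 3/2"
    by (simp add: suminf_geometric)
qed

text \<open>
  At the first index \<open>m\<close> where the digits of \<open>x\<close> and \<open>y\<close> differ they contribute \<open>(1/3) ^ m\<close> to the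
  difference of the codes, and all later digits together at most half of that.
\<close>

lemma ternary_code_separates:
  assumes "\<bar>ternary_code U x - ternary_code U y\<bar> < (1/3) ^ N / 2" "k \<le> N"
  shows "x \<in> U k \<longleftrightarrow> y \<in> U k"
proof (rule ccontr)
  assume neq: "\<not> ?thesis"
  define P where "P = (\<lambda>i. (x \<in> U i) \<noteq> (y \<in> U i))"
  define m where "m = (LEAST i. P i)"
  have "P k" using neq by (simp add: P_def)
  then have "P m" "m \<le> k"
    unfolding m_def by (rule LeastI, rule Least_le)
  then have m: "(x \<in> U m) \<noteq> (y \<in> U m)" by (simp add: P_def)
  have below: "(x \<in> U i) = (y \<in> U i)" if "i < m" for i
    using not_less_Least[of i P] that by (simp add: m_def P_def)
  define d where "d = (\<lambda>k. (indicator (U k) x - indicator (U k) y) * (1/3 :: real) ^ k)"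
  have sd: "summable d"
    unfolding d_def left_diff_distrib by (intro summable_diff summable_ternary)
  have "ternary_code U x - ternary_code U y = (\<Sum>k. d k)"
    unfolding ternary_code_def d_def left_diff_distrib
    by (rule suminf_diff[OF summable_ternary summable_ternary])
  also have "\<dots> = (\<Sum>k. d (k + Suc m)) + (\<Sum>k<Suc m. d k)"
    by (rule suminf_split_initial_segment[OF sd])
  also have "(\<Sum>k<Suc m. d k) = d m"
    using below by (simp add: d_def indicator_def)
  finally have eq: "ternary_code U x - ternary_code U y = (\<Sum>k. d (k + Suc m)) + d m" .
  have le: "\<bar>d (k + Suc m)\<bar> \<le> (1/3) ^ Suc m * (1/3) ^ k" for k
    by (auto simp: d_def indicator_def power_add)
  have sg: "summable (\<lambda>k. (1/3) ^ Suc m * (1/3 :: real) ^ k)"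
    by (intro summable_mult summable_geometric) simp
  have sa: "summable (\<lambda>k. \<bar>d (k + Suc m)\<bar>)"
    by (rule summable_comparison_test[OF _ sg]) (use le in auto)
  have "\<bar>\<Sum>k. d (k + Suc m)\<bar> \<le> (\<Sum>k. \<bar>d (k + Suc m)\<bar>)"
    by (rule summable_rabs[OF sa])
  also have "\<dots> \<le> (\<Sum>k. (1/3) ^ Suc m * (1/3 :: real) ^ k)"
    by (rule suminf_le[OF le sa sg])
  also have "\<dots> = (1/3) ^ m / 2"
    by (subst suminf_mult) (simp_all add: suminf_geometric summable_geometric)
  finally have tail: "\<bar>\<Sum>k. d (k + Suc m)\<bar> \<le> (1/3) ^ m / 2" .
  have "\<bar>d m\<bar> = (1/3) ^ m"
    using m by (auto simp: d_def indicator_def)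
  then have "(1/3) ^ m / 2 \<le> \<bar>ternary_code U x - ternary_code U y\<bar>"
    using tail unfolding eq by linarith
  moreover have "(1/3::real) ^ N \<le> (1/3) ^ m"
    using \<open>m \<le> k\<close> assms(2) by (intro power_decreasing) auto
  ultimately show False
    using assms(1) by simp
qed

text \<open>
  If \<open>N\<close> bounds the indices of a finite cover of mesh \<open>e\<close>, agreement of the digits up to \<open>N\<close> puts
  \<open>x\<close> and \<open>y\<close> into a common member of that cover. So the coding, though possibly discontinuous,
  is Borel and has a uniformly continuous inverse.
\<close>

lemma compact_metric_real_code:
  assumes X: "compact (UNIV :: 'a::metric_space set)"
  obtains s :: "'a::metric_space \<Rightarrow> real" where "s \<in> borel_measurable borel" "\<And>x. s x \<in> {0..3/2}"
    "\<And>e. 0 < e \<Longrightarrow> \<exists>d>0. \<forall>x y. \<bar>s x - s y\<bar> < d \<longrightarrow> dist x y < e"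
proof -
  obtain U :: "nat \<Rightarrow> 'a set" where U: "\<And>k. open (U k)" "\<And>e. 0 < e \<Longrightarrow> \<exists>I. fine_cover U e I"
    using countable_fine_cover[OF X] by metis
  show ?thesis
  proof (rule that[of "ternary_code U"])
    have [measurable]: "U k \<in> sets borel" for k using U(1) by simp
    show "ternary_code U \<in> borel_measurable borel"
      unfolding ternary_code_def by measurable
    show "ternary_code U x \<in> {0..3/2}" for x
      using ternary_code_bounds[of U x] by simp
    fix e :: real assume "0 < e"
    then obtain I where "fine_cover U e I" using U(2) by blast
    note I = fine_coverD[OF this]
    have "dist x y < e" if "\<bar>ternary_code U x - ternary_code U y\<bar> < (1/3) ^ Max I / 2" for x y
    proof -
      obtain k where k: "k \<in> I" "x \<in> U k" using I(2) by blast
      then have "y \<in> U k"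
        using ternary_code_separates[OF that, of k] I(1) by simp
      then show ?thesis using I(3) k by blast
    qed
    then show "\<exists>d>0. \<forall>x y. \<bar>ternary_code U x - ternary_code U y\<bar> < d \<longrightarrow> dist x y < e"
      by (intro exI[of _ "(1/3) ^ Max I / 2"]) auto
  qed
qed

text \<open>
  The uniformly continuous inverse of \<open>s\<close> extends to the closure of the range; the required limits
  exist by compactness of \<open>'a\<close>.
\<close>

lemma code_inverse:
  fixes s :: "'a::metric_space \<Rightarrow> real"
  assumes X: "compact (UNIV :: 'a set)"
    and s: "\<And>e. 0 < e \<Longrightarrow> \<exists>d>0. \<forall>x y. \<bar>s x - s y\<bar> < d \<longrightarrow> dist x y < e"
  obtains g where "continuous_on (closure (range s)) g" "\<And>x. g (s x) = x"
proof -
  have "\<exists>z. \<forall>e>0. \<exists>d>0. \<forall>x. \<bar>s x - t\<bar> < d \<longrightarrow> dist x z < e" if t: "t \<in> closure (range s)" for t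
  proof -
    obtain a where a: "\<And>n. a n \<in> range s" "a \<longlonglongrightarrow> t"
      using t unfolding closure_sequential by blast
    then have "\<forall>n. \<exists>x. a n = s x" by blast
    then obtain x where x: "\<And>n. a n = s (x n)" by metis
    obtain z r where r: "strict_mono (r :: nat \<Rightarrow> nat)" "(x \<circ> r) \<longlonglongrightarrow> z"
      using X unfolding compact_def by (metis UNIV_I)
    have lim: "(\<lambda>n. s (x (r n))) \<longlonglongrightarrow> t"
      using LIMSEQ_subseq_LIMSEQ[OF a(2) r(1)] x by (simp add: o_def)
    show ?thesis
    proof (rule exI[of _ z], intro allI impI)
      fix e :: real assume "0 < e"
      then obtain d where d: "0 < d" "\<And>x y. \<bar>s x - s y\<bar> < d \<Longrightarrow> dist x y < e / 2"
        using s[of "e / 2"] by auto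
      have "\<forall>\<^sub>F n in sequentially. dist (s (x (r n))) t < d / 2"
        using lim d(1) by (intro tendstoD) auto
      moreover have "\<forall>\<^sub>F n in sequentially. dist ((x \<circ> r) n) z < e / 2"
        using \<open>0 < e\<close> by (intro tendstoD[OF r(2)]) simp
      ultimately have "\<forall>\<^sub>F n in sequentially. dist (s (x (r n))) t < d / 2 \<and> dist ((x \<circ> r) n) z < e / 2"
        by (rule eventually_conj)
      then obtain n where n: "dist (s (x (r n))) t < d / 2" "dist (x (r n)) z < e / 2"
        using eventually_happens'[OF sequentially_bot] by auto
      have "dist x' z < e" if "\<bar>s x' - t\<bar> < d / 2" for x'
      proof -
        have "\<bar>s x' - s (x (r n))\<bar> < d"
          using that n(1) unfolding dist_real_def by linarith
        then show ?thesis
          using d(2) n(2) dist_triangle[of x' z "x (r n)"] by fastforce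
      qed
      then show "\<exists>d>0. \<forall>x. \<bar>s x - t\<bar> < d \<longrightarrow> dist x z < e"
        using d(1) by (intro exI[of _ "d / 2"]) auto
    qed
  qed
  then obtain g where g: "\<And>t e. t \<in> closure (range s) \<Longrightarrow> 0 < e \<Longrightarrow>
      \<exists>d>0. \<forall>x. \<bar>s x - t\<bar> < d \<longrightarrow> dist x (g t) < e"
    by metis
  show ?thesis
  proof (rule that[of g])
    have "range s \<subseteq> closure (range s)" by (rule closure_subset)
    then have "dist x (g (s x)) < e" if "0 < e" for x e
      using g[of "s x" e] that by fastforce
    then have "\<not> 0 < dist x (g (s x))" for x by blast
    then show "g (s x) = x" for x by (metis dist_commute zero_less_dist_iff)
    show "continuous_on (closure (range s)) g"
      unfolding continuous_on_iff
    proof (intro ballI allI impI)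
      fix t and e :: real assume t: "t \<in> closure (range s)" and "0 < e"
      then obtain d where d: "0 < d" "\<And>x. \<bar>s x - t\<bar> < d \<Longrightarrow> dist x (g t) < e / 2"
        using g[of t "e / 2"] by auto
      have "dist (g t') (g t) < e" if t': "t' \<in> closure (range s)" "dist t' t < d / 2" for t'
      proof -
        obtain d' where d': "0 < d'" "\<And>x. \<bar>s x - t'\<bar> < d' \<Longrightarrow> dist x (g t') < e / 2"
          using g[of t' "e / 2"] t' \<open>0 < e\<close> by auto
        have "0 < min d' (d / 2)" using d d' by simp
        then obtain x where "dist (s x) t' < min d' (d / 2)"
          using t'(1) unfolding closure_approachable by blast
        then have "\<bar>s x - t'\<bar> < d'" "\<bar>s x - t\<bar> < d"
          using t'(2) unfolding dist_real_def min_less_iff_conj by linarith+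
        then show ?thesis
          using d(2)[of x] d'(2)[of x] dist_triangle3[of "g t'" "g t" x] by linarith
      qed
      then show "\<exists>d>0. \<forall>t'\<in>closure (range s). dist t' t < d \<longrightarrow> dist (g t') (g t) < e"
        using d(1) by (intro exI[of _ "d / 2"]) auto
    qed
  qed
qed

text \<open>
  The coding transports a sequence of probabilities to the real line, where it lives on a bounded
  interval and Helly's selection theorem applies. The limit sits on the closure \<open>K\<close> of the set of codes
  and is carried back by the continuous decoding map. Test functions correspond as well: \<open>f\<close> composed
  with the decoding map is continuous on \<open>K\<close> and extends to the line by Tietze's theorem.
\<close>

lemma Delta_seq_compact:
  fixes ps :: "nat \<Rightarrow> 'a::metric_space measure"
  assumes X: "compact (UNIV :: 'a set)" and ps: "\<And>n. ps n \<in> Delta"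
  obtains r p where "strict_mono (r :: nat \<Rightarrow> nat)" "p \<in> Delta" "weak_lim (ps \<circ> r) p"
proof -
  obtain s :: "'a \<Rightarrow> real" where s[measurable]: "s \<in> borel_measurable borel"
    and range_s: "\<And>x. s x \<in> {0..3/2}"
    and uc: "\<And>e. 0 < e \<Longrightarrow> \<exists>d>0. \<forall>x y. \<bar>s x - s y\<bar> < d \<longrightarrow> dist x y < e"
    by (rule compact_metric_real_code[OF X]) blast
  define K where "K = closure (range s)"
  obtain g where g: "continuous_on K g" "\<And>x. g (s x) = x"
    unfolding K_def using code_inverse[OF X uc] by metis
  have sK: "s x \<in> K" for x
    unfolding K_def using closure_subset[of "range s"] by blast
  have K: "closed K" by (simp add: K_def)
  define \<mu> where "\<mu> = (\<lambda>n. distr (ps n) borel s)"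
  have s': "s \<in> ps n \<rightarrow>\<^sub>M borel" for n
    using Delta_D(2)[OF ps] by (simp cong: measurable_cong_sets)
  have \<mu>: "real_distribution (\<mu> n)" for n
    unfolding \<mu>_def using prob_space.real_distribution_distr[OF Delta_D(1)[OF ps] s'] .
  have s_bounds: "-1 < s x" "s x \<le> 2" for x
    using range_s[of x] unfolding atLeastAtMost_iff by linarith+
  have "measure (\<mu> n) {-1<..2} = 1" for n
  proof -
    interpret prob_space "ps n" using Delta_D ps by blast
    have "measure (\<mu> n) {-1<..2} = measure (ps n) (s -` {-1<..2} \<inter> space (ps n))"
      unfolding \<mu>_def using s' by (intro measure_distr) auto
    also have "s -` {-1<..2} \<inter> space (ps n) = space (ps n)"
      using s_bounds by auto
    finally show ?thesis by (simp add: prob_space)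
  qed
  then have "tight \<mu>"
    unfolding tight_def using \<mu>
    by (intro conjI allI impI exI[of _ "-1 :: real"] exI[of _ "2 :: real"]) auto
  from tight_imp_convergent_subsubsequence[OF this strict_mono_id] obtain r q where
    r: "strict_mono (r :: nat \<Rightarrow> nat)" and q: "real_distribution q" and "weak_conv_m (\<mu> \<circ> id \<circ> r) q"
    by blast
  then have conv: "weak_conv_m (\<lambda>n. \<mu> (r n)) q" by (simp add: o_def)
  interpret q: real_distribution q by fact
  have lim: "(\<lambda>n. \<integral>t. F t \<partial>\<mu> (r n)) \<longlonglongrightarrow> (\<integral>t. F t \<partial>q)"
    if "continuous_on UNIV F" "\<And>t. \<bar>F t\<bar> \<le> B" for F :: "real \<Rightarrow> real" and B
    using that \<mu> q conv
    by (intro weak_conv_imp_integral_bdd_continuous_conv[where B = B])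
       (auto simp: continuous_on_eq_continuous_at)
  have int\<mu>: "(\<integral>t. F t \<partial>\<mu> n) = (\<integral>x. F (s x) \<partial>ps n)" if "continuous_on UNIV F" for F :: "real \<Rightarrow> real" and n
    unfolding \<mu>_def using that s' by (intro integral_distr borel_measurable_continuous_onI)
  \<comment> \<open>The limit lives on \<open>K\<close>: test against the truncated distance to \<open>K\<close>.\<close>
  have "AE t in q. t \<in> K"
  proof -
    let ?F = "\<lambda>t. min 1 (infdist t K)"
    have F: "continuous_on UNIV ?F" by (intro continuous_intros)
    have bd: "\<bar>?F t\<bar> \<le> 1" for t using infdist_nonneg[of t K] by auto
    have "(\<integral>t. ?F t \<partial>\<mu> n) = 0" for n
      unfolding int\<mu>[OF F] using sK by simp
    then have "(\<lambda>n. 0) \<longlonglongrightarrow> (\<integral>t. ?F t \<partial>q)"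
      using lim[OF F bd] by simp
    then have "(\<integral>t. ?F t \<partial>q) = 0"
      using LIMSEQ_unique tendsto_const by blast
    moreover have "?F \<in> borel_measurable borel"
      using F by (rule borel_measurable_continuous_onI)
    then have "integrable q ?F"
      using F bd by (intro q.integrable_const_bound[where B = 1]) auto
    ultimately have "AE t in q. ?F t = 0"
      by (subst (asm) integral_nonneg_eq_0_iff_AE) (auto intro!: infdist_nonneg)
    then show ?thesis
    proof (rule AE_mp, intro AE_I2 impI)
      fix t assume "?F t = 0"
      then have "infdist t K = 0" by (auto simp: min_def split: if_splits)
      then show "t \<in> K" using K sK in_closed_iff_infdist_zero[of K] by blast
    qed
  qed
  note qK = this
  \<comment> \<open>\<open>q\<close> does not charge the complement of \<open>K\<close>, so the constant value there is immaterial.\<close>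
  define g' where "g' = (\<lambda>t. if t \<in> K then g t else undefined)"
  have [measurable]: "g' \<in> borel_measurable borel"
    unfolding g'_def using K g(1)
    by (intro borel_measurable_continuous_on_if) auto
  have g'm: "g' \<in> q \<rightarrow>\<^sub>M borel" by (simp cong: measurable_cong_sets)
  define p where "p = distr q borel g'"
  show ?thesis
  proof (rule that[of r p])
    show "p \<in> Delta"
      unfolding p_def Delta_iff using q.prob_space_distr[OF g'm] by simp
    show "weak_lim (ps \<circ> r) p"
      unfolding weak_lim_def
    proof (intro allI impI)
      fix f :: "'a \<Rightarrow> real" assume f: "continuous_on UNIV f"
      have fm: "f \<in> borel_measurable borel" using f by (rule borel_measurable_continuous_onI)
      obtain B where B: "\<And>x. \<bar>f x\<bar> \<le> B"
        using bounded_borel_continuous[OF X f] by (rule bounded_borelD) blast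
      have cK: "continuous_on K (f \<circ> g)"
        using g(1) f by (intro continuous_on_compose) (auto intro: continuous_on_subset)
      have "0 \<le> B" using B[of undefined] by linarith
      then obtain F where F: "continuous_on UNIV F" "\<And>t. t \<in> K \<Longrightarrow> F t = (f \<circ> g) t" "\<And>t. \<bar>F t\<bar> \<le> B"
        using Tietze[OF cK, of UNIV B] K B by auto
      have "(\<integral>x. f x \<partial>p) = (\<integral>t. f (g' t) \<partial>q)"
        unfolding p_def by (rule integral_distr[OF g'm fm])
      also have "\<dots> = (\<integral>t. F t \<partial>q)"
      proof (rule integral_cong_AE)
        show "AE t in q. f (g' t) = F t"
          using qK by eventually_elim (simp add: g'_def F(2))
        show "(\<lambda>t. f (g' t)) \<in> borel_measurable q" using measurable_compose[OF g'm fm] .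
        show "F \<in> borel_measurable q"
          using borel_measurable_continuous_onI[OF F(1)] by (simp cong: measurable_cong_sets)
      qed
      finally have "(\<integral>x. f x \<partial>p) = (\<integral>t. F t \<partial>q)" .
      moreover have "(\<integral>t. F t \<partial>\<mu> n) = (\<integral>x. f x \<partial>ps n)" for n
        unfolding int\<mu>[OF F(1)] using F(2)[OF sK] g(2) by simp
      ultimately show "(\<lambda>n. \<integral>x. f x \<partial>(ps \<circ> r) n) \<longlonglongrightarrow> (\<integral>x. f x \<partial>p)"
        using lim[OF F(1,3)] by simp
    qed
  qed (rule r)
qed

section \<open>Gambling houses and the long-run multifunction\<close>

lemma houseD:
  fixes \<Gamma> :: "'a::metric_space \<Rightarrow> 'a measure set"
  assumes "standard_gambling_house \<Gamma>"
  shows "compact (UNIV :: 'a set)" "\<Gamma> x \<subseteq> Delta" "compactin weak_star (\<Gamma> x)"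
    "dirac x \<in> \<Gamma> x" "p \<in> \<Gamma> x \<Longrightarrow> p \<in> Delta"
    "p \<in> \<Gamma> x \<Longrightarrow> \<exists>p'\<in>\<Gamma> x'. d_KR p p' \<le> dist x x'"
  using assms unfolding standard_gambling_house_def leavable_def non_expansive_def
  by (auto)

text \<open>
  The supremum defining \<open>d_KR\<close> is a genuine one because a 1-Lipschitz function oscillates by at most
  the diameter.
\<close>

lemma lipschitz_integral_le:
  fixes h :: "'a::metric_space \<Rightarrow> real"
  assumes X: "compact (UNIV :: 'a set)" and p: "p \<in> Delta" "p' \<in> Delta"
    and L: "0 \<le> L" "\<And>x x'. \<bar>h x - h x'\<bar> \<le> L * dist x x'"
  shows "\<bar>(\<integral>x. h x \<partial>p) - (\<integral>x. h x \<partial>p')\<bar> \<le> L * d_KR p p'"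
proof -
  let ?F = "{f :: 'a \<Rightarrow> real. 1-lipschitz_on UNIV f}"
  let ?d = "\<lambda>f. \<bar>(\<integral>x. f x \<partial>p) - (\<integral>x. f x \<partial>p')\<bar>"
  obtain D where D: "\<And>x y :: 'a. dist x y \<le> D"
    using compact_imp_bounded[OF X] unfolding bounded_two_points by auto
  have "?d f \<le> 2 * D" if "f \<in> ?F" for f
  proof -
    have "continuous_on UNIV f" using that lipschitz_on_continuous_on by blast
    then have b: "bounded_borel f" by (rule bounded_borel_continuous[OF X])
    have near: "\<bar>f x - f undefined\<bar> \<le> D" for x
      using lipschitz_onD[of 1 UNIV f x undefined] that D[of x undefined] by (simp add: dist_real_def)
    have "f x \<le> f undefined + D" "- f x \<le> - f undefined + D" for x
      using near[of x] by linarith+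
    then have "(\<integral>x. f x \<partial>r) \<le> f undefined + D" "(\<integral>x. - f x \<partial>r) \<le> - f undefined + D" if "r \<in> Delta" for r
      using integral_le_const_Delta[OF that b] integral_le_const_Delta[OF that bounded_borel_minus[OF b]]
      by blast+
    from this[OF p(1)] this[OF p(2)] show ?thesis by simp
  qed
  then have bdd: "bdd_above (?d ` ?F)" by (rule bdd_aboveI2)
  have le1: "?d f \<le> d_KR p p'" if "f \<in> ?F" for f
    unfolding d_KR_def using that by (intro cSUP_upper[OF _ bdd]) auto
  \<comment> \<open>Dividing by \<open>L + e\<close> instead of \<open>L\<close> covers the case \<open>L = 0\<close> as well.\<close>
  have "?d h \<le> L * d_KR p p' + e * d_KR p p'" if "0 < e" for e
  proof -
    have "(\<lambda>x. h x / (L + e)) \<in> ?F"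
    proof (intro CollectI lipschitz_onI)
      fix x y
      have "\<bar>h x - h y\<bar> \<le> (L + e) * dist x y"
        using L(2)[of x y] that by (smt (verit) mult_right_mono zero_le_dist)
      then show "dist (h x / (L + e)) (h y / (L + e)) \<le> 1 * dist x y"
        using L that by (simp add: dist_real_def divide_le_eq mult.commute flip: diff_divide_distrib)
    qed simp
    from le1[OF this] have "?d h / (L + e) \<le> d_KR p p'"
      using L that by (simp flip: diff_divide_distrib)
    then show ?thesis
      using L that by (simp add: divide_le_eq algebra_simps)
  qed
  note e = this
  have "0 \<le> d_KR p p'" using le1[of "\<lambda>_. 0"] by (simp add: lipschitz_on_def)
  show ?thesis
  proof (rule field_le_epsilon)
    fix e :: real assume "0 < e"
    have "e / (d_KR p p' + 1) * d_KR p p' \<le> e"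
      using \<open>0 < e\<close> \<open>0 \<le> d_KR p p'\<close> by (simp add: field_simps)
    then show "?d h \<le> L * d_KR p p' + e"
      using e[of "e / (d_KR p p' + 1)"] \<open>0 < e\<close> \<open>0 \<le> d_KR p p'\<close> by simp
  qed
qed

lemma lipschitz_imp_continuous:
  fixes h :: "'a::metric_space \<Rightarrow> real"
  assumes "0 \<le> L" "\<And>x x'. \<bar>h x - h x'\<bar> \<le> L * dist x x'"
  shows "continuous_on UNIV h"
  using assms by (intro lipschitz_on_continuous_on[of L] lipschitz_onI) (auto simp: dist_real_def)

text \<open>
  Non-expansiveness in the form used below, with integrands of arbitrary Lipschitz constant.
\<close>

lemma house_lipschitz:
  assumes \<Gamma>: "standard_gambling_house \<Gamma>" and p: "p \<in> \<Gamma> x"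
    and L: "0 \<le> L" "\<And>x x'. \<bar>h x - h x'\<bar> \<le> L * dist x x'"
  obtains p' where "p' \<in> \<Gamma> x'" "(\<integral>z. h z \<partial>p) \<le> (\<integral>z. h z \<partial>p') + L * dist x x'"
proof -
  obtain p' where p': "p' \<in> \<Gamma> x'" "d_KR p p' \<le> dist x x'"
    using houseD(6)[OF \<Gamma> p] by blast
  have "\<bar>(\<integral>z. h z \<partial>p) - (\<integral>z. h z \<partial>p')\<bar> \<le> L * d_KR p p'"
    using houseD(1)[OF \<Gamma>] houseD(5)[OF \<Gamma>] p p'(1) L by (intro lipschitz_integral_le) auto
  also have "\<dots> \<le> L * dist x x'"
    using p'(2) L(1) by (rule mult_left_mono)
  finally show ?thesis using p'(1) by (intro that) auto
qed

text \<open>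
  For continuous \<open>h\<close> this inequality propagates from \<open>\<Gamma>\<close> to its long-run closure.
\<close>

definition superharmonic :: "('a::topological_space \<Rightarrow> 'a measure set) \<Rightarrow> ('a \<Rightarrow> real) \<Rightarrow> bool" where
  "superharmonic \<Gamma> h \<longleftrightarrow> (\<forall>x. \<forall>p\<in>\<Gamma> x. (\<integral>z. h z \<partial>p) \<le> h x)"

abbreviation house_graph :: "('a::topological_space \<Rightarrow> 'a measure set) \<Rightarrow> ('a measure \<times> 'a measure) set" where
  "house_graph \<Gamma> \<equiv> {(dirac x, r) | x r. r \<in> \<Gamma> x}"

lemma hull_subset: "G \<subseteq> closed_convex_hull_pairs G"
  unfolding closed_convex_hull_pairs_def by blast

lemma hull_least:
  assumes "closedin (prod_topology weak_star weak_star) C" "convex_prob_pairs C" "G \<subseteq> C"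
  shows "closed_convex_hull_pairs G \<subseteq> C"
  using assms unfolding closed_convex_hull_pairs_def by blast

lemma hull_in_Delta:
  fixes \<Gamma> :: "'a::metric_space \<Rightarrow> 'a measure set"
  assumes "standard_gambling_house \<Gamma>"
  shows "closed_convex_hull_pairs (house_graph \<Gamma>) \<subseteq> Delta \<times> Delta"
proof (rule hull_least)
  show "closedin (prod_topology weak_star weak_star) (Delta \<times> Delta :: ('a measure \<times> 'a measure) set)"
    using closedin_topspace[of "prod_topology (weak_star :: 'a measure topology) weak_star"]
    by (simp add: topspace_weak_star)
  show "convex_prob_pairs (Delta \<times> Delta)"
    unfolding convex_prob_pairs_def using mix_in_Delta by blast
  show "house_graph \<Gamma> \<subseteq> Delta \<times> Delta"
    using houseD(5)[OF assms] dirac_in_Delta by blast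
qed

text \<open>
  The hypothesis excludes an empty intersection, which would be the whole type rather than a set of
  pairs of probabilities.
\<close>

lemma hull_closed:
  assumes "closed_convex_hull_pairs G \<subseteq> Delta \<times> Delta"
  shows "closedin (prod_topology weak_star weak_star) (closed_convex_hull_pairs G)"
proof -
  let ?F = "{C. closedin (prod_topology weak_star weak_star) C \<and> convex_prob_pairs C \<and> G \<subseteq> C}"
  show ?thesis
  proof (cases "?F = {}")
    case True
    then show ?thesis
      using closedin_topspace[of "prod_topology weak_star weak_star"] assms unfolding closed_convex_hull_pairs_def
      by (metis Inter_empty topspace_prod_topology topspace_weak_star top.extremum_uniqueI)
  next
    case False
    then show ?thesis
      unfolding closed_convex_hull_pairs_def by (intro closedin_Inter) auto
  qed
qed

lemma convex_prob_pairsD: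
  assumes "convex_prob_pairs C" "(p, p') \<in> C" "(q, q') \<in> C" "t \<in> {0..1}"
  shows "(mix t p q, mix t p' q') \<in> C"
  using assms unfolding convex_prob_pairs_def by fast

lemma hull_convex:
  assumes "(p, p') \<in> closed_convex_hull_pairs G" "(q, q') \<in> closed_convex_hull_pairs G" "t \<in> {0..1}"
  shows "(mix t p q, mix t p' q') \<in> closed_convex_hull_pairs G"
  unfolding closed_convex_hull_pairs_def
proof (rule InterI)
  fix C assume C: "C \<in> {C. closedin (prod_topology weak_star weak_star) C \<and> convex_prob_pairs C \<and> G \<subseteq> C}"
  then have "closed_convex_hull_pairs G \<subseteq> C" by (intro hull_least) auto
  then show "(mix t p q, mix t p' q') \<in> C"
    using C assms by (intro convex_prob_pairsD) auto
qed

text \<open>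
  The pairs satisfying the conclusion form a closed convex set containing the graph of \<open>\<Gamma>\<close>.
\<close>

lemma hull_integral_le:
  fixes h :: "'a::metric_space \<Rightarrow> real"
  assumes \<Gamma>: "standard_gambling_house \<Gamma>" and h: "continuous_on UNIV h" "superharmonic \<Gamma> h"
    and pq: "(p, q) \<in> closed_convex_hull_pairs (house_graph \<Gamma>)"
  shows "(\<integral>x. h x \<partial>q) \<le> (\<integral>x. h x \<partial>p)"
proof -
  let ?T = "prod_topology (weak_star :: 'a measure topology) weak_star"
  let ?C = "{z \<in> topspace ?T. (\<integral>x. h x \<partial>fst z) - (\<integral>x. h x \<partial>snd z) \<in> {0..}}"
  have b: "bounded_borel h"
    using houseD(1)[OF \<Gamma>] h(1) by (rule bounded_borel_continuous)
  have c: "continuous_map weak_star euclideanreal (\<lambda>p. \<integral>x. h x \<partial>p)"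
    by (rule continuous_map_integral[OF h(1)])
  have "closed_convex_hull_pairs (house_graph \<Gamma>) \<subseteq> ?C"
  proof (rule hull_least)
    show "closedin ?T ?C"
    proof (rule closedin_continuous_map_preimage)
      show "continuous_map ?T euclideanreal (\<lambda>z. (\<integral>x. h x \<partial>fst z) - (\<integral>x. h x \<partial>snd z))"
        using continuous_map_compose[OF continuous_map_fst c] continuous_map_compose[OF continuous_map_snd c]
        by (intro continuous_map_diff) (auto simp: o_def)
    qed auto
    show "house_graph \<Gamma> \<subseteq> ?C"
      using b h(2) houseD(5)[OF \<Gamma>]
      by (auto simp: topspace_weak_star dirac_in_Delta integral_dirac bounded_borel_def superharmonic_def
         )
    show "convex_prob_pairs ?C"
      unfolding convex_prob_pairs_def
    proof (clarsimp simp: topspace_weak_star mix_in_Delta)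
      fix p p' q q' :: "'a measure" and t :: real
      assume *: "p \<in> Delta" "p' \<in> Delta" "q \<in> Delta" "q' \<in> Delta" "0 \<le> t" "t \<le> 1"
        "(\<integral>x. h x \<partial>p') \<le> (\<integral>x. h x \<partial>p)" "(\<integral>x. h x \<partial>q') \<le> (\<integral>x. h x \<partial>q)"
      then show "(\<integral>x. h x \<partial>mix t p' q') \<le> (\<integral>x. h x \<partial>mix t p q)"
        using b by (simp add: integral_mix add_mono mult_left_mono)
    qed
  qed
  then show ?thesis using pq by auto
qed

lemma Gamma_tilde_pow_in_Delta:
  assumes "standard_gambling_house \<Gamma>" "p \<in> Delta"
  shows "Gamma_tilde_pow n \<Gamma> p \<subseteq> Delta"
  using assms(2)
proof (induction n arbitrary: p)
  case (Suc n)
  then show ?case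
    using hull_in_Delta[OF assms(1)] by (auto simp: Gamma_tilde_def; blast)
qed simp

lemma Gamma_tilde_pow_integral_le:
  assumes \<Gamma>: "standard_gambling_house \<Gamma>" and h: "continuous_on UNIV h" "superharmonic \<Gamma> h"
    and "q \<in> Gamma_tilde_pow n \<Gamma> p"
  shows "(\<integral>x. h x \<partial>q) \<le> (\<integral>x. h x \<partial>p)"
  using assms(4)
proof (induction n arbitrary: p)
  case (Suc n)
  then obtain p' where p': "p' \<in> Gamma_tilde \<Gamma> p" "q \<in> Gamma_tilde_pow n \<Gamma> p'" by auto
  have "(\<integral>x. h x \<partial>p') \<le> (\<integral>x. h x \<partial>p)"
    using hull_integral_le[OF \<Gamma> h] p'(1) by (simp add: Gamma_tilde_def)
  with Suc.IH[OF p'(2)] show ?case by simp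
qed simp

lemma Gamma_inf_closedin: "closedin weak_star (Gamma_inf \<Gamma> x)"
  unfolding Gamma_inf_def by simp

lemma Gamma_inf_in_Delta: "Gamma_inf \<Gamma> x \<subseteq> Delta"
  using closedin_subset[OF Gamma_inf_closedin, of \<Gamma> x] by (simp add: topspace_weak_star)

lemma Gamma_tilde_pow_subset_inf:
  assumes "standard_gambling_house \<Gamma>"
  shows "Gamma_tilde_pow n \<Gamma> (dirac x) \<subseteq> Gamma_inf \<Gamma> x"
proof -
  have "(\<Union>n. Gamma_tilde_pow n \<Gamma> (dirac x)) \<subseteq> topspace weak_star"
    using Gamma_tilde_pow_in_Delta[OF assms dirac_in_Delta] unfolding topspace_weak_star by blast
  then show ?thesis
    unfolding Gamma_inf_def using closure_of_subset by blast
qed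

lemma dirac_in_Gamma_inf:
  assumes "standard_gambling_house \<Gamma>"
  shows "dirac x \<in> Gamma_inf \<Gamma> x"
  using Gamma_tilde_pow_subset_inf[OF assms, of 0 x] by simp

lemma Gamma_inf_integral_le:
  assumes \<Gamma>: "standard_gambling_house \<Gamma>" and h: "continuous_on UNIV h" "superharmonic \<Gamma> h"
    and p: "p \<in> Gamma_inf \<Gamma> x"
  shows "(\<integral>z. h z \<partial>p) \<le> h x"
proof -
  have b: "bounded_borel h"
    using houseD(1)[OF \<Gamma>] h(1) by (rule bounded_borel_continuous)
  let ?C = "{p \<in> topspace weak_star. (\<integral>z. h z \<partial>p) \<in> {..h x}}"
  have cl: "closedin weak_star ?C"
    by (rule closedin_continuous_map_preimage[OF continuous_map_integral[OF h(1)]]) simp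
  have "Gamma_tilde_pow n \<Gamma> (dirac x) \<subseteq> ?C" for n
    using Gamma_tilde_pow_in_Delta[OF \<Gamma> dirac_in_Delta, of n x]
      Gamma_tilde_pow_integral_le[OF \<Gamma> h, of _ n "dirac x"] b
    by (auto simp: topspace_weak_star integral_dirac bounded_borel_def)
  then have "Gamma_inf \<Gamma> x \<subseteq> ?C"
    unfolding Gamma_inf_def using cl by (intro closure_of_minimal) auto
  then show ?thesis using p by auto
qed

section \<open>Lipschitz envelopes\<close>

text \<open>
  \<open>W\<close> is the largest \<open>L\<close>-Lipschitz function below \<open>w\<close>.
\<close>

lemma lipschitz_lower_envelope:
  fixes w :: "'a::metric_space \<Rightarrow> real"
  assumes bdd: "\<And>x. c \<le> w x" and L: "0 \<le> L"
  defines "W \<equiv> \<lambda>x. INF z. w z + L * dist x z"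
  shows "\<bar>W x - W x'\<bar> \<le> L * dist x x'" "W x \<le> w z + L * dist x z"
    "(\<And>z. a \<le> w z + L * dist x z) \<Longrightarrow> a \<le> W x"
proof -
  have b: "bdd_below (range (\<lambda>z. w z + L * dist x z))" for x
    using bdd L by (intro bdd_belowI2[of _ c]) (simp add: add_increasing2)
  show up: "W x \<le> w z + L * dist x z" for x z
    unfolding W_def by (rule cINF_lower[OF b]) simp
  show low: "a \<le> W x" if "\<And>z. a \<le> w z + L * dist x z" for a x
    unfolding W_def using that by (intro cINF_greatest) auto
  have "W x - L * dist x x' \<le> W x'" for x x'
  proof (rule low)
    fix z
    have "L * dist x z \<le> L * dist x x' + L * dist x' z"
      using mult_left_mono[OF dist_triangle[of x z x'] L] by (simp add: distrib_left)
    then show "W x - L * dist x x' \<le> w z + L * dist x' z"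
      using up[of x z] by linarith
  qed
  from this[of x x'] this[of x' x] show "\<bar>W x - W x'\<bar> \<le> L * dist x x'"
    by (simp add: dist_commute abs_le_iff)
qed

text \<open>
  By the inequality obtained, the \<open>L\<close>-Lipschitz lower envelope of \<open>f\<close> is at least \<open>f - e\<close>: nearby
  points are covered by uniform continuity, distant ones by making \<open>L\<close> times their distance at least
  the oscillation of \<open>f\<close>.
\<close>

lemma lipschitz_approximation_below:
  fixes f :: "'a::metric_space \<Rightarrow> real"
  assumes X: "compact (UNIV :: 'a set)" and f: "continuous_on UNIV f" and e: "0 < e"
  obtains L where "0 \<le> L" "\<And>x z. f x - e \<le> f z + L * dist x z"
proof -
  obtain B where B: "\<And>x. \<bar>f x\<bar> \<le> B"
    using bounded_borel_continuous[OF X f] by (rule bounded_borelD) blast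
  have "uniformly_continuous_on UNIV f"
    using f X by (rule compact_uniformly_continuous)
  then obtain d where d: "0 < d" "\<And>x x'. dist x' x < d \<Longrightarrow> dist (f x') (f x) < e"
    by (rule uniformly_continuous_onE[OF _ e]) blast
  have B0: "0 \<le> B" using B[of undefined] by linarith
  show ?thesis
  proof (rule that[of "2 * B / d"])
    show "0 \<le> 2 * B / d" using B0 d by simp
    fix x z
    show "f x - e \<le> f z + 2 * B / d * dist x z"
    proof (cases "dist x z < d")
      case True
      moreover have "0 \<le> 2 * B / d * dist x z" using B0 d by simp
      ultimately show ?thesis using d(2)[of x z] by (simp add: dist_real_def)
    next
      case False
      then have "2 * B / d * d \<le> 2 * B / d * dist x z"
        using B0 d by (intro mult_left_mono) auto
      then have "2 * B \<le> 2 * B / d * dist x z" using d by simp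
      then show ?thesis using B[of x] B[of z] e by linarith
    qed
  qed
qed

text \<open>
  This lets a merely Borel excessive function be replaced by a Lipschitz one. For \<open>p \<in> \<Gamma> x\<close> and any \<open>z\<close>,
  non-expansiveness gives \<open>p' \<in> \<Gamma> z\<close> with \<open>\<integral>W dp \<le> \<integral>W dp' + L * dist x z \<le> w z + L * dist x z\<close>;
  the infimum over \<open>z\<close> of the right-hand side is \<open>W x\<close>.
\<close>

lemma superharmonic_envelope:
  fixes w :: "'a::metric_space \<Rightarrow> real"
  assumes \<Gamma>: "standard_gambling_house \<Gamma>" and w: "bounded_borel w" "superharmonic \<Gamma> w"
    and L: "0 \<le> L"
  shows "superharmonic \<Gamma> (\<lambda>x. INF z. w z + L * dist x z)"
proof -
  define W where "W = (\<lambda>x. INF z. w z + L * dist x z)"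
  obtain B where B: "\<And>x. \<bar>w x\<bar> \<le> B" using w(1) by (rule bounded_borelD) blast
  then have low: "- B \<le> w x" for x using B[of x] by linarith
  have env: "\<bar>W x - W x'\<bar> \<le> L * dist x x'" "W x \<le> w z + L * dist x z"
      "(\<And>z. a \<le> w z + L * dist x z) \<Longrightarrow> a \<le> W x" for x x' z a
    unfolding W_def
    by (rule lipschitz_lower_envelope[OF low L], rule lipschitz_lower_envelope[OF low L],
        rule lipschitz_lower_envelope(3)[OF low L])
  have W: "bounded_borel W"
    by (rule bounded_borel_continuous[OF houseD(1)[OF \<Gamma>] lipschitz_imp_continuous[OF L env(1)]])
  have "(\<integral>z. W z \<partial>p) \<le> W x" if p: "p \<in> \<Gamma> x" for x p
  proof (rule env(3))
    fix z
    obtain p' where p': "p' \<in> \<Gamma> z" "(\<integral>z. W z \<partial>p) \<le> (\<integral>z. W z \<partial>p') + L * dist x z"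
      by (rule house_lipschitz[OF \<Gamma> p L env(1)]) blast
    have "(\<integral>z. W z \<partial>p') \<le> (\<integral>z. w z \<partial>p')"
      using env(2)[of z z for z] houseD(5)[OF \<Gamma> p'(1)] W w(1)
      by (intro integral_mono integrable_bounded_borel) auto
    also have "\<dots> \<le> w z" using w(2) p'(1) by (auto simp: superharmonic_def)
    finally show "(\<integral>z. W z \<partial>p) \<le> w z + L * dist x z" using p'(2) by linarith
  qed
  then show ?thesis unfolding superharmonic_def W_def by blast
qed

text \<open>
  The maximum in the definition of an excessive function is automatically attained in a leavable
  house, namely at the Dirac mass; what remains is an inequality for each section of \<open>w\<close>.
\<close>

lemma excessive_iff_superharmonic:
  fixes \<Gamma> :: "'a::metric_space \<Rightarrow> 'a measure set" and w :: "'a \<times> 'b::metric_space \<Rightarrow> real"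
  assumes \<Gamma>: "standard_gambling_house \<Gamma>" and Y: "compact (UNIV :: 'b set)"
  shows "excessive \<Gamma> w \<longleftrightarrow> bounded_borel w \<and> (\<forall>y. superharmonic \<Gamma> (\<lambda>x. w (x, y)))"
proof (cases "bounded_borel w")
  case True
  have b: "bilin w p (dirac y) = (\<integral>x. w (x, y) \<partial>p)" if "p \<in> \<Gamma> x" for p x y
    using bilin_dirac_right[OF houseD(1)[OF \<Gamma>] Y houseD(5)[OF \<Gamma> that] True] .
  have d: "bilin w (dirac x) (dirac y) = w (x, y)" for x y
    using b[OF houseD(4)[OF \<Gamma>]] bounded_borel_section(1)[OF True]
    by (simp add: integral_dirac bounded_borel_def)
  have "w (x, y) \<in> (\<lambda>p. bilin w p (dirac y)) ` \<Gamma> x" for x y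
    using houseD(4)[OF \<Gamma>, of x] by (rule rev_image_eqI) (simp add: d)
  then show ?thesis
    using True b unfolding excessive_def is_max_of_def superharmonic_def by auto
qed (simp add: excessive_def)

section \<open>A maximum principle for acyclic houses\<close>

lemma lower_semicontinuous_attains_inf:
  assumes "compact Z" "Z \<noteq> {}" "lower_semicontinuous \<phi>"
  obtains x where "x \<in> Z" "\<And>z. z \<in> Z \<Longrightarrow> \<phi> x \<le> \<phi> z"
proof (rule ccontr)
  assume "\<not> thesis"
  then have *: "\<exists>z\<in>Z. \<phi> z < \<phi> x" if "x \<in> Z" for x
    using that \<open>(\<And>x. x \<in> Z \<Longrightarrow> (\<And>z. z \<in> Z \<Longrightarrow> \<phi> x \<le> \<phi> z) \<Longrightarrow> thesis)\<close> by (meson not_le)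
  then have cover: "Z \<subseteq> (\<Union>z\<in>Z. {x. \<phi> z < \<phi> x})" by blast
  have op: "open {x. \<phi> z < \<phi> x}" for z
    using assms(3) by (simp add: lower_semicontinuous_def)
  obtain F where F: "F \<subseteq> Z" "finite F" "Z \<subseteq> (\<Union>z\<in>F. {x. \<phi> z < \<phi> x})"
    by (rule compactE_image[OF assms(1) op cover])
  then have "F \<noteq> {}" using assms(2) by auto
  then obtain m where m: "m \<in> F" "\<And>z. z \<in> F \<Longrightarrow> \<phi> m \<le> \<phi> z"
    using F(2) by (metis arg_min_if_finite(1) arg_min_least)
  then show False using F by fastforce
qed

lemma AE_eq_bound:
  assumes p: "p \<in> Delta" and f: "bounded_borel f" "\<And>x. f x \<le> M" "M \<le> (\<integral>x. f x \<partial>p)"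
  shows "AE x in p. f x = M"
proof -
  interpret prob_space p using p Delta_D by blast
  have i: "integrable p f" using p f(1) by (rule integrable_bounded_borel)
  have "(\<integral>x. M - f x \<partial>p) = M - (\<integral>x. f x \<partial>p)"
    using i by (simp add: prob_space)
  moreover have "0 \<le> (\<integral>x. M - f x \<partial>p)" using f(2) by (intro Bochner_Integration.integral_nonneg) simp
  ultimately have "(\<integral>x. M - f x \<partial>p) = 0" using f(3) by linarith
  then have "AE x in p. M - f x = 0"
    using i f(2) by (subst (asm) integral_nonneg_eq_0_iff_AE) auto
  then show ?thesis by eventually_elim simp
qed

text \<open>
  Suppose \<open>v a > w a\<close> and let \<open>W\<close> be a Lipschitz lower envelope of \<open>w\<close>, with \<open>L\<close> so large that \<open>W\<close> is
  still at least \<open>min u v - e\<close>. Among the maximisers of \<open>v - W\<close> choose \<open>x\<close> with \<open>\<phi> x\<close> minimal, which is possible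
  because \<open>\<phi>\<close> is lower semicontinuous. There \<open>v x > u x\<close>, so by \<open>E\<close> some long-run \<open>p \<noteq> dirac x\<close> also
  maximises the integral of \<open>v\<close>. Since \<open>W\<close> cannot increase along \<open>p\<close>, the difference \<open>v - W\<close> does not
  decrease, so \<open>p\<close> is carried by its maximisers, where \<open>\<phi> \<ge> \<phi> x\<close>. Then \<open>p\<close> does as well as \<open>dirac x\<close>
  for \<open>\<phi>\<close>, contrary to strong acyclicity.
\<close>

lemma superharmonic_majorant:
  fixes u v w :: "'a::metric_space \<Rightarrow> real"
  assumes \<Gamma>: "standard_gambling_house \<Gamma>" and acyclic: "strongly_acyclic_max \<Gamma>"
    and u: "continuous_on UNIV u" and v: "continuous_on UNIV v" "superharmonic \<Gamma> v"
    and w: "bounded_borel w" "superharmonic \<Gamma> w" "\<And>x. min (u x) (v x) \<le> w x"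
    and E: "\<And>x. Argmax_on (Gamma_inf \<Gamma> x) (\<lambda>p. \<integral>z. v z \<partial>p) = {dirac x} \<Longrightarrow> v x \<le> u x"
  shows "v a \<le> w a"
proof (rule ccontr)
  assume "\<not> v a \<le> w a"
  \<comment> \<open>Half of the gap is given away to the Lipschitz approximation.\<close>
  define e where "e = (v a - w a) / 2"
  have e: "0 < e" "w a + e < v a" using \<open>\<not> v a \<le> w a\<close> by (auto simp: e_def field_simps)
  note X = houseD(1)[OF \<Gamma>]
  obtain \<phi> where \<phi>: "bounded_borel \<phi>" "lower_semicontinuous \<phi>"
      "\<And>x. Argmax_on (Gamma_inf \<Gamma> x) (\<lambda>p. \<integral>z. \<phi> z \<partial>p) = {dirac x}"
    using acyclic unfolding strongly_acyclic_max_def by blast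
  have "continuous_on UNIV (\<lambda>x. min (u x) (v x))"
    using u v(1) by (intro continuous_intros)
  then obtain L where L: "0 \<le> L" "\<And>x z. min (u x) (v x) - e \<le> min (u z) (v z) + L * dist x z"
    using lipschitz_approximation_below[OF X _ e(1)] by blast
  obtain B where B: "\<And>x. \<bar>w x\<bar> \<le> B" using w(1) by (rule bounded_borelD) blast
  then have low: "- B \<le> w x" for x using B[of x] by linarith
  define W where "W = (\<lambda>x. INF z. w z + L * dist x z)"
  have W_lip: "\<bar>W x - W x'\<bar> \<le> L * dist x x'" for x x'
    unfolding W_def by (rule lipschitz_lower_envelope[OF low L(1)])
  have W_le: "W x \<le> w x" for x
    using lipschitz_lower_envelope(2)[OF low L(1), where x = x and z = x] by (simp add: W_def)
  have W_ge: "min (u x) (v x) - e \<le> W x" for x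
    unfolding W_def
  proof (rule lipschitz_lower_envelope(3)[OF low L(1)])
    show "min (u x) (v x) - e \<le> w z + L * dist x z" for z
      using L(2)[of x z] w(3)[of z] by linarith
  qed
  have W_super: "superharmonic \<Gamma> W"
    unfolding W_def by (rule superharmonic_envelope[OF \<Gamma> w(1,2) L(1)])
  have W_cont: "continuous_on UNIV W"
    by (rule lipschitz_imp_continuous[OF L(1) W_lip])
  define d where "d = (\<lambda>x. v x - W x)"
  have d_cont: "continuous_on UNIV d"
    unfolding d_def using v(1) W_cont by (intro continuous_intros)
  obtain m where m: "\<And>x. d x \<le> d m"
    using continuous_attains_sup[OF X UNIV_not_empty d_cont] by auto
  define Z where "Z = {x. d x = d m}"
  have "closed Z"
    unfolding Z_def using d_cont by (intro closed_Collect_eq continuous_intros)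
  then have "compact Z" using compact_Int_closed[OF X, of Z] by simp
  moreover have "Z \<noteq> {}" by (auto simp: Z_def)
  ultimately obtain x where x: "x \<in> Z" "\<And>z. z \<in> Z \<Longrightarrow> \<phi> x \<le> \<phi> z"
    using lower_semicontinuous_attains_inf[OF _ _ \<phi>(2)] by metis
  have dx: "d z \<le> d x" for z using m x(1) by (simp add: Z_def)
  have "e < d a" using W_le[of a] e(2) by (simp add: d_def)
  then have "u x < v x" using dx[of a] W_ge[of x] by (simp add: d_def min_def split: if_splits)
  then have "Argmax_on (Gamma_inf \<Gamma> x) (\<lambda>p. \<integral>z. v z \<partial>p) \<noteq> {dirac x}" using E[of x] by auto
  moreover have vm: "v \<in> borel_measurable borel" "\<phi> \<in> borel_measurable borel"
    using v(1) \<phi>(1) by (auto intro: borel_measurable_continuous_onI simp: bounded_borel_def)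
  then have "dirac x \<in> Argmax_on (Gamma_inf \<Gamma> x) (\<lambda>p. \<integral>z. v z \<partial>p)"
    using dirac_in_Gamma_inf[OF \<Gamma>] Gamma_inf_integral_le[OF \<Gamma> v]
    by (simp add: Argmax_on_def integral_dirac)
  ultimately obtain p where p: "p \<in> Argmax_on (Gamma_inf \<Gamma> x) (\<lambda>p. \<integral>z. v z \<partial>p)" "p \<noteq> dirac x"
    by blast
  then have pinf: "p \<in> Gamma_inf \<Gamma> x" and "(\<integral>z. v z \<partial>dirac x) \<le> (\<integral>z. v z \<partial>p)"
    using dirac_in_Gamma_inf[OF \<Gamma>, of x] by (auto simp: Argmax_on_def)
  then have pv: "v x \<le> (\<integral>z. v z \<partial>p)" using vm by (simp add: integral_dirac)
  have pD: "p \<in> Delta" using pinf Gamma_inf_in_Delta by blast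
  have bb: "bounded_borel v" "bounded_borel W" "bounded_borel d"
    using bounded_borel_continuous[OF X] v(1) W_cont d_cont by auto
  have "(\<integral>z. d z \<partial>p) = (\<integral>z. v z \<partial>p) - (\<integral>z. W z \<partial>p)"
    unfolding d_def using bb pD by (intro Bochner_Integration.integral_diff integrable_bounded_borel)
  then have "d x \<le> (\<integral>z. d z \<partial>p)"
    using pv Gamma_inf_integral_le[OF \<Gamma> W_cont W_super pinf] by (simp add: d_def)
  then have "AE z in p. d z = d x"
    using dx by (intro AE_eq_bound[OF pD bb(3)])
  then have ae: "AE z in p. \<phi> x \<le> \<phi> z"
    by eventually_elim (use x in \<open>simp add: Z_def\<close>)
  interpret prob_space p using pD Delta_D by blast
  have "(\<integral>z. \<phi> x \<partial>p) \<le> (\<integral>z. \<phi> z \<partial>p)"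
    using ae integrable_bounded_borel[OF pD \<phi>(1)] by (intro integral_mono_AE) auto
  then have ge: "(\<integral>z. \<phi> z \<partial>dirac x) \<le> (\<integral>z. \<phi> z \<partial>p)"
    using vm by (simp add: integral_dirac prob_space)
  have "dirac x \<in> Argmax_on (Gamma_inf \<Gamma> x) (\<lambda>p. \<integral>z. \<phi> z \<partial>p)" using \<phi>(3) by simp
  then have "p \<in> Argmax_on (Gamma_inf \<Gamma> x) (\<lambda>p. \<integral>z. \<phi> z \<partial>p)"
    using pinf ge by (auto simp: Argmax_on_def intro: order_trans)
  then show False using \<phi>(3) p(2) by simp
qed

section \<open>Iterated one-step maxima and the long-run multifunction\<close>

definition best_bet :: "('a::topological_space \<Rightarrow> 'a measure set) \<Rightarrow> ('a \<Rightarrow> real) \<Rightarrow> 'a \<Rightarrow> real" where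
  "best_bet \<Gamma> h x = (SUP p\<in>\<Gamma> x. \<integral>z. h z \<partial>p)"

lemma best_bet_attained:
  assumes \<Gamma>: "standard_gambling_house \<Gamma>" and h: "continuous_on UNIV h"
  obtains p where "p \<in> \<Gamma> x" "best_bet \<Gamma> h x = (\<integral>z. h z \<partial>p)" "\<And>q. q \<in> \<Gamma> x \<Longrightarrow> (\<integral>z. h z \<partial>q) \<le> (\<integral>z. h z \<partial>p)"
proof -
  have "compact ((\<lambda>p. \<integral>z. h z \<partial>p) ` \<Gamma> x)"
    using image_compactin[OF houseD(3)[OF \<Gamma>] continuous_map_integral[OF h]] by simp
  moreover have "\<Gamma> x \<noteq> {}" using houseD(4)[OF \<Gamma>] by blast
  ultimately obtain p where p: "p \<in> \<Gamma> x" "\<And>q. q \<in> \<Gamma> x \<Longrightarrow> (\<integral>z. h z \<partial>q) \<le> (\<integral>z. h z \<partial>p)"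
    using compact_attains_sup[of "(\<lambda>p. \<integral>z. h z \<partial>p) ` \<Gamma> x"] by auto
  have "best_bet \<Gamma> h x = (\<integral>z. h z \<partial>p)"
    unfolding best_bet_def using p by (intro cSup_eq_maximum) auto
  with p show ?thesis by (intro that)
qed

lemma best_bet_upper:
  assumes \<Gamma>: "standard_gambling_house \<Gamma>" and h: "continuous_on UNIV h" and "p \<in> \<Gamma> x"
  shows "(\<integral>z. h z \<partial>p) \<le> best_bet \<Gamma> h x"
  using best_bet_attained[OF \<Gamma> h, of x] assms(3) by metis

lemma best_bet_ge:
  assumes \<Gamma>: "standard_gambling_house \<Gamma>" and h: "continuous_on UNIV h"
  shows "h x \<le> best_bet \<Gamma> h x"
  using best_bet_upper[OF \<Gamma> h houseD(4)[OF \<Gamma>], of x] borel_measurable_continuous_onI[OF h]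
  by (simp add: integral_dirac)

lemma best_bet_le_add:
  assumes \<Gamma>: "standard_gambling_house \<Gamma>" and h: "continuous_on UNIV h" "continuous_on UNIV h'"
    and le: "\<And>x. h x \<le> h' x + c"
  shows "best_bet \<Gamma> h x \<le> best_bet \<Gamma> h' x + c"
proof -
  note b = bounded_borel_continuous[OF houseD(1)[OF \<Gamma>]]
  obtain p where p: "p \<in> \<Gamma> x" "best_bet \<Gamma> h x = (\<integral>z. h z \<partial>p)"
    using best_bet_attained[OF \<Gamma> h(1)] by metis
  have pD: "p \<in> Delta" using houseD(5)[OF \<Gamma> p(1)] .
  interpret prob_space p using pD Delta_D by blast
  have i: "integrable p h" "integrable p h'"
    using b h pD by (auto intro: integrable_bounded_borel)
  have "(\<integral>z. h z \<partial>p) \<le> (\<integral>z. h' z + c \<partial>p)"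
    using i le by (intro integral_mono) auto
  also have "\<dots> = (\<integral>z. h' z \<partial>p) + c"
    using i by (simp add: prob_space)
  also have "\<dots> \<le> best_bet \<Gamma> h' x + c"
    using best_bet_upper[OF \<Gamma> h(2) p(1)] by simp
  finally show ?thesis using p(2) by simp
qed

lemma best_bet_lipschitz:
  assumes \<Gamma>: "standard_gambling_house \<Gamma>" and L: "0 \<le> L" "\<And>x x'. \<bar>h x - h x'\<bar> \<le> L * dist x x'"
  shows "\<bar>best_bet \<Gamma> h x - best_bet \<Gamma> h x'\<bar> \<le> L * dist x x'"
proof -
  note h = lipschitz_imp_continuous[OF L]
  have "best_bet \<Gamma> h x \<le> best_bet \<Gamma> h x' + L * dist x x'" for x x'
  proof -
    obtain p where p: "p \<in> \<Gamma> x" "best_bet \<Gamma> h x = (\<integral>z. h z \<partial>p)"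
      using best_bet_attained[OF \<Gamma> h] by metis
    obtain p' where "p' \<in> \<Gamma> x'" "(\<integral>z. h z \<partial>p) \<le> (\<integral>z. h z \<partial>p') + L * dist x x'"
      by (rule house_lipschitz[OF \<Gamma> p(1) L])
    then show ?thesis using best_bet_upper[OF \<Gamma> h, of p' x'] p(2) by linarith
  qed
  from this[of x x'] this[of x' x] show ?thesis by (simp add: dist_commute abs_le_iff)
qed

abbreviation iterated_bet where
  "iterated_bet \<Gamma> n h \<equiv> (best_bet \<Gamma> ^^ n) h"

lemma iterated_bet_lipschitz:
  assumes \<Gamma>: "standard_gambling_house \<Gamma>" and L: "0 \<le> L" "\<And>x x'. \<bar>h x - h x'\<bar> \<le> L * dist x x'"
  shows "\<bar>iterated_bet \<Gamma> n h x - iterated_bet \<Gamma> n h x'\<bar> \<le> L * dist x x'"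
proof (induction n arbitrary: x x')
  case (Suc n)
  show ?case using best_bet_lipschitz[OF \<Gamma> L(1) Suc.IH] by simp
qed (simp add: L)

text \<open>
  The pair consisting of \<open>p\<close> and the law after one optimal bet from a \<open>p\<close>-distributed start belongs to
  the closed convex hull. A measurable choice of optimal bets is avoided: the set of those \<open>p\<close> for which a
  suitable \<open>q\<close> exists contains the Dirac masses, is stable under mixtures, and is stable under limits
  because a convergent subsequence of the \<open>q\<close>'s can be extracted.
\<close>

lemma hull_follows_best_bet:
  fixes h :: "'a::metric_space \<Rightarrow> real"
  assumes \<Gamma>: "standard_gambling_house \<Gamma>" and L: "0 \<le> L" "\<And>x x'. \<bar>h x - h x'\<bar> \<le> L * dist x x'"
    and p: "p \<in> Delta"
  obtains q where "q \<in> Gamma_tilde \<Gamma> p" "(\<integral>x. best_bet \<Gamma> h x \<partial>p) \<le> (\<integral>x. h x \<partial>q)"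
proof -
  define G where "G = closed_convex_hull_pairs (house_graph \<Gamma>)"
  let ?T = "best_bet \<Gamma> h"
  note X = houseD(1)[OF \<Gamma>]
  have h: "continuous_on UNIV h" by (rule lipschitz_imp_continuous[OF L])
  have T: "continuous_on UNIV ?T"
    by (rule lipschitz_imp_continuous[OF L(1) best_bet_lipschitz[OF \<Gamma> L]])
  have b: "bounded_borel h" "bounded_borel ?T"
    using bounded_borel_continuous[OF X] h T by auto
  have GD: "G \<subseteq> Delta \<times> Delta" unfolding G_def by (rule hull_in_Delta[OF \<Gamma>])
  have G_closed: "closedin (prod_topology weak_star weak_star) G"
    using GD unfolding G_def by (rule hull_closed)
  \<comment> \<open>Mixtures and limits preserve the property because \<open>G\<close> is convex and closed.\<close>
  define S where "S = {p. \<exists>q. (p, q) \<in> G \<and> (\<integral>x. ?T x \<partial>p) \<le> (\<integral>x. h x \<partial>q)}"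
  have "p \<in> S"
  proof (rule Delta_induct[OF X p])
    fix x
    obtain q where q: "q \<in> \<Gamma> x" "?T x = (\<integral>z. h z \<partial>q)"
      using best_bet_attained[OF \<Gamma> h] by metis
    have "(dirac x, q) \<in> house_graph \<Gamma>" using q(1) by auto
    then have "(dirac x, q) \<in> G" unfolding G_def by (rule subsetD[OF hull_subset])
    moreover have "(\<integral>z. ?T z \<partial>dirac x) = ?T x" using b(2) by (simp add: integral_dirac bounded_borel_def)
    ultimately show "dirac x \<in> S" using q(2) by (auto simp: S_def)
  next
    fix p p' t assume pp: "p \<in> S" "p' \<in> S" "p \<in> Delta" "p' \<in> Delta" and t: "t \<in> {0..1::real}"
    obtain q where q: "(p, q) \<in> G" "(\<integral>x. ?T x \<partial>p) \<le> (\<integral>x. h x \<partial>q)" using pp(1) by (auto simp: S_def)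
    obtain q' where q': "(p', q') \<in> G" "(\<integral>x. ?T x \<partial>p') \<le> (\<integral>x. h x \<partial>q')" using pp(2) by (auto simp: S_def)
    have D: "q \<in> Delta" "q' \<in> Delta" using GD q(1) q'(1) by auto
    have "(mix t p p', mix t q q') \<in> G" using q(1) q'(1) t unfolding G_def by (rule hull_convex)
    moreover have "(\<integral>x. ?T x \<partial>mix t p p') \<le> (\<integral>x. h x \<partial>mix t q q')"
      unfolding integral_mix[OF pp(3,4) t b(2)] integral_mix[OF D t b(1)]
      using q(2) q'(2) t by (intro add_mono mult_left_mono) auto
    ultimately show "mix t p p' \<in> S" unfolding S_def by blast
  next
    fix ps p assume ps: "\<And>n. ps n \<in> S" "\<And>n. ps n \<in> Delta" and pD: "p \<in> Delta" and lim: "weak_lim ps p"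
    have "\<exists>q. (ps n, q) \<in> G \<and> (\<integral>x. ?T x \<partial>ps n) \<le> (\<integral>x. h x \<partial>q)" for n
      using ps(1)[of n] unfolding S_def by blast
    then obtain qs where qs: "\<And>n. (ps n, qs n) \<in> G" "\<And>n. (\<integral>x. ?T x \<partial>ps n) \<le> (\<integral>x. h x \<partial>qs n)"
      by metis
    have qD: "qs n \<in> Delta" for n using GD qs(1)[of n] by auto
    obtain r q where r: "strict_mono (r :: nat \<Rightarrow> nat)" and q: "q \<in> Delta" "weak_lim (qs \<circ> r) q"
      by (rule Delta_seq_compact[OF X, of qs]) (use qD in auto)
    have lim': "weak_lim (ps \<circ> r) p"
      using lim LIMSEQ_subseq_LIMSEQ[OF _ r] unfolding weak_lim_def by (auto simp: o_def)
    have "limitin (prod_topology weak_star weak_star) (\<lambda>n. ((ps \<circ> r) n, (qs \<circ> r) n)) (p, q) sequentially"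
      unfolding limitin_pairwise
      using limitin_weak_star[OF _ pD lim'] limitin_weak_star[OF _ q] ps(2) qD by (simp add: o_def)
    then have "(p, q) \<in> G"
      by (rule limitin_closedin[OF _ G_closed]) (use qs(1) in auto)
    moreover have "(\<integral>x. ?T x \<partial>p) \<le> (\<integral>x. h x \<partial>q)"
    proof (rule LIMSEQ_le)
      show "(\<lambda>n. \<integral>x. ?T x \<partial>(ps \<circ> r) n) \<longlonglongrightarrow> (\<integral>x. ?T x \<partial>p)"
        using lim' T unfolding weak_lim_def by blast
      show "(\<lambda>n. \<integral>x. h x \<partial>(qs \<circ> r) n) \<longlonglongrightarrow> (\<integral>x. h x \<partial>q)"
        using q(2) h unfolding weak_lim_def by blast
    qed (use qs(2) in auto)
    ultimately show "p \<in> S" unfolding S_def by blast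
  qed
  then obtain q where "(p, q) \<in> G" and le: "(\<integral>x. ?T x \<partial>p) \<le> (\<integral>x. h x \<partial>q)"
    unfolding S_def by auto
  then have "q \<in> Gamma_tilde \<Gamma> p" by (simp add: Gamma_tilde_def G_def)
  then show ?thesis using le by (rule that)
qed

lemma pow_follows_iterated_bet:
  fixes h :: "'a::metric_space \<Rightarrow> real"
  assumes \<Gamma>: "standard_gambling_house \<Gamma>" and L: "0 \<le> L" "\<And>x x'. \<bar>h x - h x'\<bar> \<le> L * dist x x'"
    and p: "p \<in> Delta"
  shows "\<exists>q\<in>Gamma_tilde_pow n \<Gamma> p. (\<integral>x. iterated_bet \<Gamma> n h x \<partial>p) \<le> (\<integral>x. h x \<partial>q)"
  using p
proof (induction n arbitrary: p)
  case (Suc n)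
  obtain p' where p': "p' \<in> Gamma_tilde \<Gamma> p"
      "(\<integral>x. best_bet \<Gamma> (iterated_bet \<Gamma> n h) x \<partial>p) \<le> (\<integral>x. iterated_bet \<Gamma> n h x \<partial>p')"
    by (rule hull_follows_best_bet[OF \<Gamma> L(1) iterated_bet_lipschitz[OF \<Gamma> L] Suc.prems])
  have "p' \<in> Delta"
    using p'(1) hull_in_Delta[OF \<Gamma>] unfolding Gamma_tilde_def by blast
  from Suc.IH[OF this] obtain q where "q \<in> Gamma_tilde_pow n \<Gamma> p'"
      "(\<integral>x. iterated_bet \<Gamma> n h x \<partial>p') \<le> (\<integral>x. h x \<partial>q)" by blast
  moreover from this have "q \<in> Gamma_tilde_pow (Suc n) \<Gamma> p" using p'(1) by auto
  ultimately show ?case using p'(2) by (intro bexI[of _ q]) auto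
qed simp

text \<open>
  The smallest superharmonic majorant of a Lipschitz function \<open>h\<close>, as value iteration computes it.
\<close>

definition limit_bet :: "('a::topological_space \<Rightarrow> 'a measure set) \<Rightarrow> ('a \<Rightarrow> real) \<Rightarrow> 'a \<Rightarrow> real" where
  "limit_bet \<Gamma> h x = (SUP n. iterated_bet \<Gamma> n h x)"

context
  fixes \<Gamma> :: "'a::metric_space \<Rightarrow> 'a measure set" and h :: "'a \<Rightarrow> real" and L :: real
  assumes \<Gamma>: "standard_gambling_house \<Gamma>"
    and L: "0 \<le> L" "\<And>x x'. \<bar>h x - h x'\<bar> \<le> L * dist x x'"
begin

lemma iterated_bet_continuous: "continuous_on UNIV (iterated_bet \<Gamma> n h)"
  by (rule lipschitz_imp_continuous[OF L(1) iterated_bet_lipschitz[OF \<Gamma> L]])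

lemma iterated_bet_incseq: "incseq (\<lambda>n. iterated_bet \<Gamma> n h x)"
  using best_bet_ge[OF \<Gamma> iterated_bet_continuous] by (intro incseq_SucI) simp

lemma iterated_bet_le:
  assumes "\<And>x. h x \<le> B"
  shows "iterated_bet \<Gamma> n h x \<le> B"
proof (induction n arbitrary: x)
  case (Suc n)
  have "best_bet \<Gamma> (iterated_bet \<Gamma> n h) x \<le> best_bet \<Gamma> (\<lambda>_. 0) x + B"
    using Suc.IH by (intro best_bet_le_add[OF \<Gamma> iterated_bet_continuous]) auto
  moreover have "best_bet \<Gamma> (\<lambda>_. 0) x = 0"
    using best_bet_attained[OF \<Gamma>, of "\<lambda>_. 0" x] by (metis continuous_on_const integral_zero)
  ultimately show ?case by simp
qed (simp add: assms)

lemma iterated_bet_bdd: "bdd_above (range (\<lambda>n. iterated_bet \<Gamma> n h x))"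
proof -
  have "bounded_borel h"
    by (rule bounded_borel_continuous[OF houseD(1)[OF \<Gamma>] lipschitz_imp_continuous[OF L]])
  then obtain B where "\<And>x. \<bar>h x\<bar> \<le> B" by (rule bounded_borelD) blast
  then have "h x \<le> B" for x by (meson abs_le_D1)
  then show ?thesis by (intro bdd_aboveI2[where M = B] iterated_bet_le)
qed

lemma limit_bet_upper: "iterated_bet \<Gamma> n h x \<le> limit_bet \<Gamma> h x"
  unfolding limit_bet_def by (rule cSUP_upper[OF UNIV_I iterated_bet_bdd])

lemma limit_bet_least: "(\<And>n. iterated_bet \<Gamma> n h x \<le> c) \<Longrightarrow> limit_bet \<Gamma> h x \<le> c"
  unfolding limit_bet_def by (rule cSUP_least) auto

lemma limit_bet_lipschitz: "\<bar>limit_bet \<Gamma> h x - limit_bet \<Gamma> h x'\<bar> \<le> L * dist x x'"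
proof -
  have "limit_bet \<Gamma> h x \<le> limit_bet \<Gamma> h x' + L * dist x x'" for x x'
  proof (rule limit_bet_least)
    show "iterated_bet \<Gamma> n h x \<le> limit_bet \<Gamma> h x' + L * dist x x'" for n
      using iterated_bet_lipschitz[OF \<Gamma> L, of n x x'] limit_bet_upper[of n x'] by linarith
  qed
  from this[of x x'] this[of x' x] show ?thesis by (simp add: dist_commute abs_le_iff)
qed

text \<open>
  Integrate \<open>iterated_bet \<Gamma> n h\<close> against \<open>p \<in> \<Gamma> x\<close>: the result is at most \<open>iterated_bet \<Gamma> (n + 1) h x\<close>;
  then let \<open>n\<close> tend to infinity.
\<close>

lemma limit_bet_superharmonic: "superharmonic \<Gamma> (limit_bet \<Gamma> h)"
  unfolding superharmonic_def
proof (intro allI ballI)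
  fix x p assume p: "p \<in> \<Gamma> x"
  note pD = houseD(5)[OF \<Gamma> p] and X = houseD(1)[OF \<Gamma>]
  interpret prob_space p using pD Delta_D by blast
  let ?T = "\<lambda>n. iterated_bet \<Gamma> n h"
  have W: "continuous_on UNIV (limit_bet \<Gamma> h)"
    by (rule lipschitz_imp_continuous[OF L(1) limit_bet_lipschitz])
  note ib = integrable_bounded_borel[OF pD bounded_borel_continuous[OF X]]
  have "(\<lambda>n. \<integral>z. ?T n z \<partial>p) \<longlonglongrightarrow> (\<integral>z. limit_bet \<Gamma> h z \<partial>p)"
  proof (rule integral_dominated_convergence[where w = "\<lambda>z. \<bar>h z\<bar> + \<bar>limit_bet \<Gamma> h z\<bar>"])
    show "integrable p (\<lambda>z. \<bar>h z\<bar> + \<bar>limit_bet \<Gamma> h z\<bar>)"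
      using W lipschitz_imp_continuous[OF L] by (intro ib continuous_intros)
    show "AE z in p. (\<lambda>n. ?T n z) \<longlonglongrightarrow> limit_bet \<Gamma> h z"
      unfolding limit_bet_def
      using LIMSEQ_incseq_SUP[OF iterated_bet_bdd iterated_bet_incseq] by simp
    have "\<bar>?T n z\<bar> \<le> \<bar>h z\<bar> + \<bar>limit_bet \<Gamma> h z\<bar>" for n z
      using limit_bet_upper[of n z] incseqD[OF iterated_bet_incseq, of 0 n z] by simp
    then show "AE z in p. norm (?T n z) \<le> \<bar>h z\<bar> + \<bar>limit_bet \<Gamma> h z\<bar>" for n by simp
  qed (use ib[OF W] ib[OF iterated_bet_continuous] in \<open>auto dest: borel_measurable_integrable\<close>)
  then show "(\<integral>z. limit_bet \<Gamma> h z \<partial>p) \<le> limit_bet \<Gamma> h x"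
  proof (rule LIMSEQ_le_const2, intro exI allI impI)
    fix n
    have "(\<integral>z. ?T n z \<partial>p) \<le> ?T (Suc n) x"
      using best_bet_upper[OF \<Gamma> iterated_bet_continuous p] by simp
    also have "\<dots> \<le> limit_bet \<Gamma> h x" by (rule limit_bet_upper)
    finally show "(\<integral>z. ?T n z \<partial>p) \<le> limit_bet \<Gamma> h x" .
  qed
qed

end

section \<open>The three implications for one player\<close>

lemma iterated_bet_Suc: "iterated_bet \<Gamma> (Suc n) h = best_bet \<Gamma> (iterated_bet \<Gamma> n h)"
  by simp

lemma iterated_bet_le_add:
  assumes \<Gamma>: "standard_gambling_house \<Gamma>"
    and h: "0 \<le> L" "\<And>x x'. \<bar>h x - h x'\<bar> \<le> L * dist x x'"
    and h': "0 \<le> L" "\<And>x x'. \<bar>h' x - h' x'\<bar> \<le> L * dist x x'"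
    and le: "\<And>x. h x \<le> h' x + c"
  shows "iterated_bet \<Gamma> n h x \<le> iterated_bet \<Gamma> n h' x + c"
proof (induction n arbitrary: x)
  case (Suc n)
  show ?case
    unfolding iterated_bet_Suc
    by (rule best_bet_le_add[OF \<Gamma> iterated_bet_continuous[OF \<Gamma> h] iterated_bet_continuous[OF \<Gamma> h'] Suc.IH])
qed (simp add: le)

lemma limit_bet_le_add:
  assumes \<Gamma>: "standard_gambling_house \<Gamma>"
    and h: "0 \<le> L" "\<And>x x'. \<bar>h x - h x'\<bar> \<le> L * dist x x'"
    and h': "0 \<le> L" "\<And>x x'. \<bar>h' x - h' x'\<bar> \<le> L * dist x x'"
    and le: "\<And>x. h x \<le> h' x + c"
  shows "limit_bet \<Gamma> h x \<le> limit_bet \<Gamma> h' x + c"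
proof (rule limit_bet_least)
  show "iterated_bet \<Gamma> n h x \<le> limit_bet \<Gamma> h' x + c" for n
    using iterated_bet_le_add[OF \<Gamma> h h' le, of n x] limit_bet_upper[OF \<Gamma> h', of n x] by linarith
qed (use assms in auto)

text \<open>
  Computing the limit separately for each \<open>y\<close> gives a jointly Lipschitz, hence Borel, function of both
  variables: in \<open>x\<close> by non-expansiveness, in \<open>y\<close> because each step is non-expansive in the sup norm.
\<close>

lemma excessive_limit_bet:
  fixes h :: "'a::metric_space \<times> 'b::metric_space \<Rightarrow> real"
  assumes \<Gamma>: "standard_gambling_house \<Gamma>" and Y: "compact (UNIV :: 'b set)"
    and L: "0 \<le> L" "\<And>z z'. \<bar>h z - h z'\<bar> \<le> L * dist z z'"
  shows "excessive \<Gamma> (\<lambda>(x, y). limit_bet \<Gamma> (\<lambda>x'. h (x', y)) x)"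
proof -
  let ?W = "\<lambda>(x, y). limit_bet \<Gamma> (\<lambda>x'. h (x', y)) x"
  have hx: "\<bar>h (x, y) - h (x', y)\<bar> \<le> L * dist x x'" for x x' y
    using L(2)[of "(x, y)" "(x', y)"] by (simp add: dist_Pair_Pair)
  have hy: "h (x, y) \<le> h (x, y') + L * dist y y'" for x y y'
    using L(2)[of "(x, y)" "(x, y')"] by (simp add: dist_Pair_Pair)
  have "\<bar>?W z - ?W z'\<bar> \<le> (2 * L) * dist z z'" for z z'
  proof -
    obtain x y x' y' where z: "z = (x, y)" "z' = (x', y')" by (cases z, cases z')
    have "\<bar>limit_bet \<Gamma> (\<lambda>x'. h (x', y)) x - limit_bet \<Gamma> (\<lambda>x'. h (x', y)) x'\<bar> \<le> L * dist x x'"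
      by (rule limit_bet_lipschitz[OF \<Gamma> L(1) hx])
    moreover have "limit_bet \<Gamma> (\<lambda>x. h (x, y)) x' \<le> limit_bet \<Gamma> (\<lambda>x. h (x, y')) x' + L * dist y y'"
      by (rule limit_bet_le_add[OF \<Gamma> L(1) hx L(1) hx hy])
    moreover have "limit_bet \<Gamma> (\<lambda>x. h (x, y')) x' \<le> limit_bet \<Gamma> (\<lambda>x. h (x, y)) x' + L * dist y' y"
      by (rule limit_bet_le_add[OF \<Gamma> L(1) hx L(1) hx hy])
    ultimately have "\<bar>?W z - ?W z'\<bar> \<le> L * dist x x' + L * dist y y'"
      unfolding z by (simp add: dist_commute)
    also have "\<dots> \<le> L * dist z z' + L * dist z z'"
      using L(1) dist_fst_le[of z z'] dist_snd_le[of z z'] by (intro add_mono mult_left_mono) (auto simp: z)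
    finally show ?thesis by simp
  qed
  then have "continuous_on UNIV ?W"
    using L(1) by (intro lipschitz_imp_continuous[of "2 * L"]) auto
  moreover have "compact (UNIV :: ('a \<times> 'b) set)"
    using compact_Times[OF houseD(1)[OF \<Gamma>] Y] by simp
  ultimately have "bounded_borel ?W" by (intro bounded_borel_continuous)
  then show ?thesis
    unfolding excessive_iff_superharmonic[OF \<Gamma> Y]
    using limit_bet_superharmonic[OF \<Gamma> L(1) hx] by simp
qed

lemma continuous_section:
  assumes "continuous_on UNIV g"
  shows "continuous_on UNIV (\<lambda>x. g (x, y))"
proof (rule continuous_on_compose2[OF assms])
  show "continuous_on UNIV (\<lambda>x. (x, y))" by (intro continuous_intros)
qed simp

text \<open>
  For a Lipschitz \<open>h\<close> between \<open>f = min u v\<close> and \<open>f + e\<close>, the limit of value iteration from \<open>h\<close> is an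
  excessive majorant of \<open>f\<close>, so it dominates \<open>v\<close>; some finite stage is then already within \<open>e\<close> of
  \<open>v (x, y)\<close> and is realised by a long-run probability. Sequential compactness removes the error and
  gives \<open>p\<close> with \<open>v (x, y) \<le> \<integral>f dp\<close>. As \<open>\<integral>f dp \<le> \<integral>v dp \<le> v (x, y)\<close>, equality holds throughout, and
  \<open>f \<le> u\<close> yields the remaining inequality.
\<close>

lemma MZ1_imp_P1:
  fixes u v :: "'a::metric_space \<times> 'b::metric_space \<Rightarrow> real"
  assumes \<Gamma>: "standard_gambling_house \<Gamma>" and Y: "compact (UNIV :: 'b set)"
    and u: "continuous_on UNIV u" and v: "continuous_on UNIV v" and MZ: "MZ1 \<Gamma> u v"
  shows "P1 \<Gamma> u v"
  unfolding P1_def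
proof (intro allI)
  fix x y
  note X = houseD(1)[OF \<Gamma>]
  have XY: "compact (UNIV :: ('a \<times> 'b) set)"
    using compact_Times[OF X Y] by simp
  define f where "f = (\<lambda>z. min (u z) (v z))"
  have f: "continuous_on UNIV f"
    unfolding f_def using u v by (intro continuous_intros)
  have exc: "excessive \<Gamma> v" and least: "\<And>w. excessive \<Gamma> w \<Longrightarrow> f \<le> w \<Longrightarrow> v \<le> w"
    using MZ unfolding MZ1_def is_Exc_def f_def by auto
  have approx: "\<exists>q\<in>Gamma_inf \<Gamma> x. v (x, y) - 2 * e \<le> (\<integral>x'. f (x', y) \<partial>q)" if e: "0 < e" for e
  proof -
    have "continuous_on UNIV (\<lambda>z. - f z)" using f by (intro continuous_intros)
    then obtain L where L: "0 \<le> L" "\<And>z z'. - f z - e \<le> - f z' + L * dist z z'"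
      by (rule lipschitz_approximation_below[OF XY _ e]) blast
    obtain B where B: "\<And>z. \<bar>f z\<bar> \<le> B"
      using bounded_borel_continuous[OF XY f] by (rule bounded_borelD) blast
    then have low: "- B \<le> - f z" for z using B[of z] by linarith
    define h where "h = (\<lambda>z. - (INF z'. - f z' + L * dist z z'))"
    have h_lip: "\<bar>h z - h z'\<bar> \<le> L * dist z z'" for z z'
      using lipschitz_lower_envelope(1)[where w = "\<lambda>z. - f z", OF low L(1), of z z'] unfolding h_def by linarith
    have h_ge: "f z \<le> h z" for z
      using lipschitz_lower_envelope(2)[where w = "\<lambda>z. - f z", OF low L(1), of z z] by (simp add: h_def)
    have h_le: "h z \<le> f z + e" for z
      using lipschitz_lower_envelope(3)[where w = "\<lambda>z. - f z", OF low L(1), of "- f z - e" z] L(2) by (simp add: h_def)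
    have hx: "\<bar>h (x, y) - h (x', y)\<bar> \<le> L * dist x x'" for x x' y
      using h_lip[of "(x, y)" "(x', y)"] by (simp add: dist_Pair_Pair)
    let ?h = "\<lambda>x'. h (x', y)"
    have "f \<le> (\<lambda>(x, y). limit_bet \<Gamma> (\<lambda>x'. h (x', y)) x)"
    proof (rule le_funI)
      fix z :: "'a \<times> 'b"
      show "f z \<le> (\<lambda>(x, y). limit_bet \<Gamma> (\<lambda>x'. h (x', y)) x) z"
        using h_ge[of z] limit_bet_upper[OF \<Gamma> L(1) hx[where y = "snd z"], of 0 "fst z"]
        by (simp add: case_prod_beta)
    qed
    from le_funD[OF least[OF excessive_limit_bet[OF \<Gamma> Y L(1) h_lip] this], of "(x, y)"]
    have "v (x, y) \<le> limit_bet \<Gamma> ?h x" by simp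
    then have "\<not> limit_bet \<Gamma> ?h x \<le> v (x, y) - e" using e by linarith
    then obtain n where n: "v (x, y) - e < iterated_bet \<Gamma> n ?h x"
      using limit_bet_least[OF \<Gamma> L(1) hx[where y = y], of x "v (x, y) - e"] not_le by blast
    obtain q where q: "q \<in> Gamma_tilde_pow n \<Gamma> (dirac x)"
        "(\<integral>z. iterated_bet \<Gamma> n ?h z \<partial>dirac x) \<le> (\<integral>z. ?h z \<partial>q)"
      using pow_follows_iterated_bet[OF \<Gamma> L(1) hx dirac_in_Delta] by blast
    have "(\<integral>z. iterated_bet \<Gamma> n ?h z \<partial>dirac x) = iterated_bet \<Gamma> n ?h x"
      using iterated_bet_continuous[OF \<Gamma> L(1) hx] by (intro integral_dirac borel_measurable_continuous_onI)
    moreover have qI: "q \<in> Gamma_inf \<Gamma> x" using q(1) Gamma_tilde_pow_subset_inf[OF \<Gamma>] by blast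
    then have qD: "q \<in> Delta" using Gamma_inf_in_Delta by blast
    interpret prob_space q using qD Delta_D by blast
    have i: "integrable q (\<lambda>x'. f (x', y))" "integrable q ?h"
      using continuous_section[OF f] lipschitz_imp_continuous[OF L(1) hx]
      by (auto intro!: integrable_bounded_borel[OF qD] bounded_borel_continuous[OF X])
    have "(\<integral>z. ?h z \<partial>q) \<le> (\<integral>x'. f (x', y) + e \<partial>q)"
      using i h_le by (intro integral_mono) auto
    then have "(\<integral>z. ?h z \<partial>q) \<le> (\<integral>x'. f (x', y) \<partial>q) + e"
      using i by (simp add: prob_space)
    ultimately show ?thesis
      using n q(2) qI by (intro bexI[of _ q]) auto
  qed
  have "\<exists>q\<in>Gamma_inf \<Gamma> x. v (x, y) - 2 * inverse (real (Suc n)) \<le> (\<integral>x'. f (x', y) \<partial>q)" for n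
    by (rule approx) simp
  then obtain qs where qs: "\<And>n. qs n \<in> Gamma_inf \<Gamma> x"
      "\<And>n. v (x, y) - 2 * inverse (real (Suc n)) \<le> (\<integral>x'. f (x', y) \<partial>qs n)"
    by metis
  have qD: "qs n \<in> Delta" for n using qs(1) Gamma_inf_in_Delta by blast
  obtain r p where r: "strict_mono (r :: nat \<Rightarrow> nat)" and p: "p \<in> Delta" "weak_lim (qs \<circ> r) p"
    by (rule Delta_seq_compact[OF X, of qs]) (use qD in auto)
  have "limitin weak_star (qs \<circ> r) p sequentially"
    using limitin_weak_star[OF _ p] qD by simp
  then have pI: "p \<in> Gamma_inf \<Gamma> x"
    by (rule limitin_closedin[OF _ Gamma_inf_closedin]) (use qs(1) in auto)
  have "v (x, y) \<le> (\<integral>x'. f (x', y) \<partial>p)"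
  proof (rule LIMSEQ_le)
    have "(\<lambda>n. v (x, y) - 2 * inverse (real (Suc n))) \<longlonglongrightarrow> v (x, y) - 2 * 0"
      by (intro tendsto_intros LIMSEQ_inverse_real_of_nat)
    from LIMSEQ_subseq_LIMSEQ[OF this r]
    show "(\<lambda>n. v (x, y) - 2 * inverse (real (Suc (r n)))) \<longlonglongrightarrow> v (x, y)" by (simp add: o_def)
    show "(\<lambda>n. \<integral>x'. f (x', y) \<partial>(qs \<circ> r) n) \<longlonglongrightarrow> (\<integral>x'. f (x', y) \<partial>p)"
      using p(2) continuous_section[OF f] unfolding weak_lim_def by blast
  qed (use qs(2) in auto)
  moreover have i: "integrable p (\<lambda>x'. g (x', y))" if "continuous_on UNIV g" for g :: "'a \<times> 'b \<Rightarrow> real"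
    using continuous_section[OF that] by (intro integrable_bounded_borel[OF p(1)] bounded_borel_continuous[OF X])
  have "(\<integral>x'. f (x', y) \<partial>p) \<le> (\<integral>x'. v (x', y) \<partial>p)" "(\<integral>x'. f (x', y) \<partial>p) \<le> (\<integral>x'. u (x', y) \<partial>p)"
    using i f u v by (auto intro!: integral_mono simp: f_def)
  moreover have "(\<integral>x'. v (x', y) \<partial>p) \<le> v (x, y)"
    using exc unfolding excessive_iff_superharmonic[OF \<Gamma> Y]
    by (intro Gamma_inf_integral_le[OF \<Gamma> continuous_section[OF v] _ pI]) auto
  moreover have "bilin g p (dirac y) = (\<integral>x'. g (x', y) \<partial>p)" if "continuous_on UNIV g" for g :: "'a \<times> 'b \<Rightarrow> real"
    by (rule bilin_dirac_right[OF X Y p(1) bounded_borel_continuous[OF XY that]])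
  ultimately show "\<exists>p\<in>Gamma_inf \<Gamma> x. v (x, y) = bilin v p (dirac y) \<and> bilin v p (dirac y) \<le> bilin u p (dirac y)"
    using u v pI by (intro bexI[of _ p]) auto
qed

lemma Argmax_bilin_eq:
  fixes v :: "'a::metric_space \<times> 'b::metric_space \<Rightarrow> real"
  assumes \<Gamma>: "standard_gambling_house \<Gamma>" and Y: "compact (UNIV :: 'b set)" and v: "bounded_borel v"
  shows "Argmax_on (Gamma_inf \<Gamma> x) (\<lambda>p. bilin v p (dirac y)) = Argmax_on (Gamma_inf \<Gamma> x) (\<lambda>p. \<integral>x'. v (x', y) \<partial>p)"
  using bilin_dirac_right[OF houseD(1)[OF \<Gamma>] Y _ v, of _ y] Gamma_inf_in_Delta[of \<Gamma> x]
  unfolding Argmax_on_def by (auto simp: subset_iff)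

text \<open>
  The probability supplied by \<open>P1\<close> is a maximiser, hence the Dirac mass if that is the only one.
\<close>

lemma P1_imp_E1:
  fixes u v :: "'a::metric_space \<times> 'b::metric_space \<Rightarrow> real"
  assumes \<Gamma>: "standard_gambling_house \<Gamma>" and Y: "compact (UNIV :: 'b set)"
    and u: "continuous_on UNIV u" and v: "continuous_on UNIV v" "excessive \<Gamma> v" and P: "P1 \<Gamma> u v"
  shows "E1 \<Gamma> u v"
  unfolding E1_def
proof (intro allI impI)
  fix x y
  assume A: "Argmax_on (Gamma_inf \<Gamma> x) (\<lambda>p. bilin v p (dirac y)) = {dirac x}"
  note X = houseD(1)[OF \<Gamma>]
  have XY: "compact (UNIV :: ('a \<times> 'b) set)" using compact_Times[OF X Y] by simp
  have bd: "bilin g (dirac x) (dirac y) = g (x, y)" if "continuous_on UNIV g" for g :: "'a \<times> 'b \<Rightarrow> real"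
    using bilin_dirac_right[OF X Y dirac_in_Delta bounded_borel_continuous[OF XY that]]
      bounded_borel_section(1)[OF bounded_borel_continuous[OF XY that]]
    by (simp add: integral_dirac bounded_borel_def)
  obtain p where p: "p \<in> Gamma_inf \<Gamma> x" "v (x, y) = bilin v p (dirac y)" "bilin v p (dirac y) \<le> bilin u p (dirac y)"
    using P unfolding P1_def by blast
  have "dirac x \<in> Argmax_on (Gamma_inf \<Gamma> x) (\<lambda>p. bilin v p (dirac y))" using A by simp
  then have "p \<in> Argmax_on (Gamma_inf \<Gamma> x) (\<lambda>p. bilin v p (dirac y))"
    using p(1,2) bd[OF v(1)] by (simp add: Argmax_on_def)
  then have "p = dirac x" using A by simp
  then show "v (x, y) \<le> u (x, y)" using p bd[OF u] by simp
qed

text \<open>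
  The maximum principle \<open>superharmonic_majorant\<close>, applied to each section.
\<close>

lemma E1_imp_MZ1:
  fixes u v :: "'a::metric_space \<times> 'b::metric_space \<Rightarrow> real"
  assumes \<Gamma>: "standard_gambling_house \<Gamma>" and Y: "compact (UNIV :: 'b set)"
    and u: "continuous_on UNIV u" and v: "continuous_on UNIV v" "excessive \<Gamma> v"
    and acyclic: "strongly_acyclic_max \<Gamma>" and E: "E1 \<Gamma> u v"
  shows "MZ1 \<Gamma> u v"
  unfolding MZ1_def is_Exc_def
proof (intro conjI allI impI le_funI)
  fix w :: "'a \<times> 'b \<Rightarrow> real" and z :: "'a \<times> 'b"
  assume w: "excessive \<Gamma> w \<and> (\<lambda>z. min (u z) (v z)) \<le> w"
  obtain a y where z: "z = (a, y)" by (cases z)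
  have "v (a, y) \<le> w (a, y)"
  proof (rule superharmonic_majorant[OF \<Gamma> acyclic continuous_section[OF u] continuous_section[OF v(1)], where w = "\<lambda>x. w (x, y)"])
    show "superharmonic \<Gamma> (\<lambda>x. v (x, y))"
      using v(2) unfolding excessive_iff_superharmonic[OF \<Gamma> Y] by blast
    show "bounded_borel (\<lambda>x. w (x, y))" "superharmonic \<Gamma> (\<lambda>x. w (x, y))"
      using w unfolding excessive_iff_superharmonic[OF \<Gamma> Y] by (auto intro: bounded_borel_section)
    show "min (u (x, y)) (v (x, y)) \<le> w (x, y)" for x
      using w by (auto simp: le_fun_def)
    show "v (x, y) \<le> u (x, y)"
      if "Argmax_on (Gamma_inf \<Gamma> x) (\<lambda>p. \<integral>x'. v (x', y) \<partial>p) = {dirac x}" for x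
    proof -
      have "bounded_borel v" using v(2) by (simp add: excessive_def)
      from Argmax_bilin_eq[OF \<Gamma> Y this] show ?thesis
        using E that unfolding E1_def by simp
    qed
  qed
  then show "v z \<le> w z" by (simp add: z)
qed (use v in auto)

section \<open>Exchanging the players\<close>

text \<open>
  The game seen from the other player: the roles of \<open>X\<close> and \<open>Y\<close> are swapped and the payoff changes
  sign, which turns every statement about minima into one about maxima.
\<close>

definition exchange :: "('a \<times> 'b \<Rightarrow> real) \<Rightarrow> 'b \<times> 'a \<Rightarrow> real" where
  "exchange w = (\<lambda>(y, x). - w (x, y))"

lemma exchange_apply [simp]: "exchange w (y, x) = - w (x, y)"
  by (simp add: exchange_def)

lemma exchange_exchange [simp]: "exchange (exchange w) = w"
  by (auto simp: exchange_def)

lemma exchange_le_iff: "exchange w \<le> exchange w' \<longleftrightarrow> w' \<le> w"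
  by (auto simp: exchange_def le_fun_def)

lemma exchange_max: "exchange (\<lambda>z. max (u z) (v z)) = (\<lambda>z. min (exchange u z) (exchange v z))"
  by (auto simp: exchange_def max_def min_def)

lemma exchange_continuous:
  fixes w :: "'a::topological_space \<times> 'b::topological_space \<Rightarrow> real"
  assumes "continuous_on UNIV w"
  shows "continuous_on UNIV (exchange w)"
proof -
  have "exchange w = (\<lambda>z. - w (snd z, fst z))" by (auto simp: exchange_def)
  moreover have "continuous_on UNIV (\<lambda>z::'b \<times> 'a. w (snd z, fst z))"
    by (rule continuous_on_compose2[OF assms]) (auto intro!: continuous_intros)
  ultimately show ?thesis by (simp add: continuous_on_minus)
qed

lemma bounded_borel_exchange:
  fixes w :: "'a::topological_space \<times> 'b::topological_space \<Rightarrow> real"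
  assumes "bounded_borel w"
  shows "bounded_borel (exchange w)"
proof -
  obtain B where B: "\<And>z. \<bar>w z\<bar> \<le> B" and m: "w \<in> borel_measurable borel"
    using assms by (rule bounded_borelD) blast
  have "(\<lambda>z::'b \<times> 'a. (snd z, fst z)) \<in> borel_measurable borel"
    by (intro borel_measurable_continuous_onI continuous_intros)
  from measurable_compose[OF this m] have "(\<lambda>z::'b \<times> 'a. - w (snd z, fst z)) \<in> borel_measurable borel"
    by simp
  moreover have "exchange w = (\<lambda>z. - w (snd z, fst z))" by (auto simp: exchange_def)
  ultimately show ?thesis using B by (intro bounded_borelI[of _ B]) auto
qed

lemma bounded_borel_exchange_iff: "bounded_borel (exchange w) \<longleftrightarrow> bounded_borel w"
  using bounded_borel_exchange[of w] bounded_borel_exchange[of "exchange w"] by auto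

context
  fixes \<Lambda> :: "'b::metric_space \<Rightarrow> 'b measure set"
  assumes \<Lambda>: "standard_gambling_house \<Lambda>" and X: "compact (UNIV :: 'a::metric_space set)"
begin

lemma bilin_exchange:
  fixes w :: "'a \<times> 'b \<Rightarrow> real"
  assumes "bounded_borel w" "q \<in> Delta"
  shows "bilin (exchange w) q (dirac x) = - bilin w (dirac x) q"
  using bilin_dirac_right[OF houseD(1)[OF \<Lambda>] X assms(2) bounded_borel_exchange[OF assms(1)]]
    bilin_dirac_left[OF assms(1)] by simp

lemma depressive_iff_excessive_exchange:
  fixes w :: "'a \<times> 'b \<Rightarrow> real"
  shows "depressive \<Lambda> w \<longleftrightarrow> excessive \<Lambda> (exchange w)"
proof (cases "bounded_borel w")
  case True
  have "(\<lambda>q. bilin (exchange w) q (dirac x)) ` \<Lambda> y = uminus ` (\<lambda>q. bilin w (dirac x) q) ` \<Lambda> y" for x y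
    unfolding image_image using bilin_exchange[OF True houseD(5)[OF \<Lambda>]] by (intro image_cong) auto
  then have "is_max_of (exchange w (y, x)) ((\<lambda>q. bilin (exchange w) q (dirac x)) ` \<Lambda> y) \<longleftrightarrow>
      is_min_of (w (x, y)) ((\<lambda>q. bilin w (dirac x) q) ` \<Lambda> y)" for x y
    unfolding is_max_of_def is_min_of_def by auto
  then show ?thesis
    using True bounded_borel_exchange[OF True] unfolding depressive_def excessive_def by auto
qed (simp add: depressive_def excessive_def bounded_borel_exchange_iff)

lemma MZ2_iff_MZ1_exchange:
  fixes u v :: "'a \<times> 'b \<Rightarrow> real"
  shows "MZ2 \<Lambda> u v \<longleftrightarrow> MZ1 \<Lambda> (exchange u) (exchange v)"
proof -
  have "(\<forall>w. excessive \<Lambda> w \<and> exchange g \<le> w \<longrightarrow> exchange v \<le> w) \<longleftrightarrow>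
      (\<forall>w. depressive \<Lambda> w \<and> w \<le> g \<longrightarrow> w \<le> v)" for g
    unfolding depressive_iff_excessive_exchange
    by (metis exchange_exchange exchange_le_iff)
  then show ?thesis
    unfolding MZ2_def MZ1_def is_Exc_def is_Dep_def exchange_max[symmetric] exchange_le_iff
      depressive_iff_excessive_exchange by simp
qed

lemma P2_iff_P1_exchange:
  fixes u v :: "'a \<times> 'b \<Rightarrow> real"
  assumes "bounded_borel u" "bounded_borel v"
  shows "P2 \<Lambda> u v \<longleftrightarrow> P1 \<Lambda> (exchange u) (exchange v)"
proof -
  have "q \<in> Delta" if "q \<in> Gamma_inf \<Lambda> y" for q y
    using that Gamma_inf_in_Delta by blast
  then show ?thesis
    unfolding P1_def P2_def using bilin_exchange[OF assms(1)] bilin_exchange[OF assms(2)]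
    by (auto)
qed

lemma E2_iff_E1_exchange:
  fixes u v :: "'a \<times> 'b \<Rightarrow> real"
  assumes "bounded_borel v"
  shows "E2 \<Lambda> u v \<longleftrightarrow> E1 \<Lambda> (exchange u) (exchange v)"
proof -
  have "q \<in> Delta" if "q \<in> Gamma_inf \<Lambda> y" for q y
    using that Gamma_inf_in_Delta by blast
  then have "Argmax_on (Gamma_inf \<Lambda> y) (\<lambda>q. bilin (exchange v) q (dirac x)) =
      Argmin_on (Gamma_inf \<Lambda> y) (\<lambda>q. bilin v (dirac x) q)" for x y
    unfolding Argmax_on_def Argmin_on_def using bilin_exchange[OF assms]
    by (auto)
  then show ?thesis unfolding E1_def E2_def by auto
qed

end

lemma strongly_acyclic_max_if_min:
  assumes "strongly_acyclic_min \<Lambda>"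
  shows "strongly_acyclic_max \<Lambda>"
proof -
  obtain \<psi> where \<psi>: "bounded_borel \<psi>" "upper_semicontinuous \<psi>"
      "\<And>y. Argmin_on (Gamma_inf \<Lambda> y) (\<lambda>q. \<integral>z. \<psi> z \<partial>q) = {dirac y}"
    using assms unfolding strongly_acyclic_min_def by blast
  have "{x. a < - \<psi> x} = {x. \<psi> x < - a}" for a by auto
  then have "lower_semicontinuous (\<lambda>z. - \<psi> z)"
    using \<psi>(2) by (simp add: lower_semicontinuous_def upper_semicontinuous_def)
  moreover have "Argmax_on (Gamma_inf \<Lambda> y) (\<lambda>q. \<integral>z. - \<psi> z \<partial>q) = {dirac y}" for y
    using \<psi>(3)[of y] by (simp add: Argmax_on_def Argmin_on_def)
  ultimately show ?thesis
    unfolding strongly_acyclic_max_def using bounded_borel_minus[OF \<psi>(1)] by blast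
qed

theorem proposition7p9:
  fixes \<Gamma> :: "'a::metric_space \<Rightarrow> 'a measure set"
    and \<Lambda> :: "'b::metric_space \<Rightarrow> 'b measure set"
    and u v :: "'a \<times> 'b \<Rightarrow> real"
  assumes "standard_gambling_game \<Gamma> \<Lambda> u"
    and "continuous_on UNIV v"
    and "excessive \<Gamma> v"
    and "depressive \<Lambda> v"
  shows "(strongly_acyclic_max \<Gamma> \<and> E1 \<Gamma> u v \<longrightarrow> MZ1 \<Gamma> u v) \<and>
    (strongly_acyclic_min \<Lambda> \<and> E2 \<Lambda> u v \<longrightarrow> MZ2 \<Lambda> u v) \<and>
    (strongly_acyclic_max \<Gamma> \<and> strongly_acyclic_min \<Lambda> \<longrightarrow>
       ((MZ1 \<Gamma> u v \<and> MZ2 \<Lambda> u v) \<longleftrightarrow> (P1 \<Gamma> u v \<and> P2 \<Lambda> u v)) \<and>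
       ((P1 \<Gamma> u v \<and> P2 \<Lambda> u v) \<longleftrightarrow> (E1 \<Gamma> u v \<and> E2 \<Lambda> u v)))"
proof -
  have \<Gamma>: "standard_gambling_house \<Gamma>" and \<Lambda>: "standard_gambling_house \<Lambda>" and u: "continuous_on UNIV u"
    using assms(1) by (auto simp: standard_gambling_game_def)
  note v = assms(2)
  note X = houseD(1)[OF \<Gamma>] and Y = houseD(1)[OF \<Lambda>]
  have XY: "compact (UNIV :: ('a \<times> 'b) set)" using compact_Times[OF X Y] by simp
  note bu = bounded_borel_continuous[OF XY u] and bv = bounded_borel_continuous[OF XY v]
  note cu = exchange_continuous[OF u] and cv = exchange_continuous[OF v]
  have v': "excessive \<Lambda> (exchange v)"
    using assms(4) depressive_iff_excessive_exchange[OF \<Lambda> X] by blast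
  note iffs = MZ2_iff_MZ1_exchange[OF \<Lambda> X] P2_iff_P1_exchange[OF \<Lambda> X bu bv] E2_iff_E1_exchange[OF \<Lambda> X bv]
  have "strongly_acyclic_max \<Gamma> \<Longrightarrow> E1 \<Gamma> u v \<Longrightarrow> MZ1 \<Gamma> u v"
    by (rule E1_imp_MZ1[OF \<Gamma> Y u v assms(3)])
  moreover have "MZ1 \<Gamma> u v \<Longrightarrow> P1 \<Gamma> u v"
    by (rule MZ1_imp_P1[OF \<Gamma> Y u v])
  moreover have "P1 \<Gamma> u v \<Longrightarrow> E1 \<Gamma> u v"
    by (rule P1_imp_E1[OF \<Gamma> Y u v assms(3)])
  moreover have "strongly_acyclic_min \<Lambda> \<Longrightarrow> E2 \<Lambda> u v \<Longrightarrow> MZ2 \<Lambda> u v"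
    unfolding iffs by (rule E1_imp_MZ1[OF \<Lambda> X cu cv v' strongly_acyclic_max_if_min])
  moreover have "MZ2 \<Lambda> u v \<Longrightarrow> P2 \<Lambda> u v"
    unfolding iffs by (rule MZ1_imp_P1[OF \<Lambda> X cu cv])
  moreover have "P2 \<Lambda> u v \<Longrightarrow> E2 \<Lambda> u v"
    unfolding iffs by (rule P1_imp_E1[OF \<Lambda> X cu cv v'])
  ultimately show ?thesis by blast
qed

end
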